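(* Let $X$ be a proper, geodesic, Gromov-hyperbolic metric space and let $\Gamma<\mathrm{Isom}(X)$ be discrete, virtually torsion-free and non-elementary. Then $$h_{\mathrm{top}}(\Gamma\backslash\mathrm{Geod}(X),\bar\Phi_1)\ge h_{\mathrm{crit}}(X;\Gamma).$$
   Context: Let $(X,d)$ be a metric space. $X$ is proper if closed balls are compact. A geodesic line is an isometric embedding $\gamma\colon\mathbb{R}\to X$. $X$ is Gromov-hyperbolic if there is $\delta\ge 0$ such that $(x,z)_w\ge\min\{(x,y)_w,(y,z)_w\}-\delta$ for all $x,y,z,w\in X$, where $(y,z)_x=\frac12(d(x,y)+d(x,z)-d(y,z))$. $\partial X$ is the Gromov boundary. $\Gamma<\mathrm{Isom}(X)$ is discrete if for all $x\in X$, $R\ge0$ the set $\{g\in\Gamma: d(x,gx)\le R\}$ is finite; non-elementary if its limit set $\Lambda(\Gamma)\subseteq\partial X$ (accumulation points of an orbit $\Gamma x$) has more than 2 points. The critical exponent is $h_{\mathrm{crit}}(X;\Gamma)=\limsup_{T\to+\infty}\frac1T\log\#(\Gamma x\cap B(x,T))\in[0,+\infty]$, for any $x\in X$ (independent of $x$). $\mathrm{Geod}(X)$ is the space of geodesic lines of $X$ with the topology of uniform convergence on compact subsets of $\mathbb{R}$, and $(\Phi_t\gamma)(\cdot)=\gamma(\cdot+t)$. $\Gamma$ acts by $(g\gamma)(\cdot)=g\gamma(\cdot)$, commuting with $\Phi_t$; $\bar\Phi_t$ is the induced action on $\Gamma\backslash\mathrm{Geod}(X)$. For a metrizable space $Y$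 and continuous $T\colon Y\to Y$, $$h_{\mathrm{top}}(Y,T)=\inf_{\rho}\sup_K\lim_{r\to0}\limsup_{n\to+\infty}\frac1n\log\mathrm{Cov}_{\rho^n}(K,r),$$ where $\rho$ ranges over metrics inducing the topology of $Y$, $K$ over compact subsets of $Y$, $\rho^n(y,y')=\max_{0\le i\le n-1}\rho(T^iy,T^iy')$, and $\mathrm{Cov}_{\rho^n}(K,r)$ is the minimal number of $\rho^n$-balls of radius $r$ needed to cover $K$. *)

theory Defs
  imports "HOL-Analysis.Analysis" "HOL-Algebra.Coset"
begin

definition proper_space :: "'a::metric_space itself \<Rightarrow> bool" where
  "proper_space _ \<longleftrightarrow> (\<forall>(x::'a) r. compact (cball x r))"

definition geodesic_space :: "'a::metric_space itself \<Rightarrow> bool" where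
  "geodesic_space _ \<longleftrightarrow>
     (\<forall>x y :: 'a. \<exists>c :: real \<Rightarrow> 'a. c 0 = x \<and> c (dist x y) = y \<and>
        (\<forall>s\<in>{0..dist x y}. \<forall>t\<in>{0..dist x y}. dist (c s) (c t) = \<bar>s - t\<bar>))"

text \<open>\<open>gromov_product w y z\<close> is the Gromov product of \<open>y\<close> and \<open>z\<close> based at \<open>w\<close>.\<close>

definition gromov_product :: "'a::metric_space \<Rightarrow> 'a \<Rightarrow> 'a \<Rightarrow> real" where
  "gromov_product w y z = (dist w y + dist w z - dist y z) / 2"

definition gromov_hyperbolic :: "'a::metric_space itself \<Rightarrow> bool" where
  "gromov_hyperbolic _ \<longleftrightarrow>
     (\<exists>\<delta>\<ge>0. \<forall>x y z w :: 'a.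
        gromov_product w x z \<ge> min (gromov_product w x y) (gromov_product w y z) - \<delta>)"

text \<open>
  The Gromov boundary consists of the classes of Gromov sequences. Two base points change the
  Gromov product by at most their distance, so quantifying over all of them is harmless. The
  relation below is an equivalence on Gromov sequences when the space is Gromov-hyperbolic.
\<close>

definition asymptotic_seqs :: "(nat \<Rightarrow> 'a::metric_space) \<Rightarrow> (nat \<Rightarrow> 'a) \<Rightarrow> bool" where
  "asymptotic_seqs u v \<longleftrightarrow>
     (\<forall>w. filterlim (\<lambda>(i, j). gromov_product w (u i) (v j)) at_top
            (sequentially \<times>\<^sub>F sequentially))"

definition gromov_sequences :: "(nat \<Rightarrow> 'a::metric_space) set" where
  "gromov_sequences = {u. asymptotic_seqs u u}"

definition gromov_boundary :: "(nat \<Rightarrow> 'a::metric_space) set set" where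
  "gromov_boundary =
     gromov_sequences // {(u, v). u \<in> gromov_sequences \<and> v \<in> gromov_sequences \<and> asymptotic_seqs u v}"

definition isometry_group :: "('a::metric_space \<Rightarrow> 'a) monoid" where
  "isometry_group =
     \<lparr>carrier = {g. surj g \<and> (\<forall>x y. dist (g x) (g y) = dist x y)}, mult = (\<circ>), one = id\<rparr>"

lemma group_isometry_group: "group (isometry_group :: ('a::metric_space \<Rightarrow> 'a) monoid)"
proof (rule groupI)
  fix g :: "'a \<Rightarrow> 'a"
  assume "g \<in> carrier isometry_group"
  then have s: "surj g" and d: "\<And>x y. dist (g x) (g y) = dist x y"
    by (auto simp: isometry_group_def)
  have "inj g"
    by (rule injI) (metis d dist_eq_0_iff)
  then have "surj (inv_into UNIV g)"
    by (rule inj_imp_surj_inv)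
  moreover have "dist (inv_into UNIV g x) (inv_into UNIV g y) = dist x y" for x y
    using d[of "inv_into UNIV g x" "inv_into UNIV g y"] by (simp add: surj_f_inv_f[OF s])
  ultimately show "\<exists>h\<in>carrier isometry_group. h \<otimes>\<^bsub>isometry_group\<^esub> g = \<one>\<^bsub>isometry_group\<^esub>"
    using \<open>inj g\<close> by (intro bexI[of _ "inv_into UNIV g"]) (auto simp: isometry_group_def)
next
  fix g h :: "'a \<Rightarrow> 'a"
  assume "g \<in> carrier isometry_group" "h \<in> carrier isometry_group"
  then show "g \<otimes>\<^bsub>isometry_group\<^esub> h \<in> carrier isometry_group"
    using comp_surj[of h g] by (simp add: isometry_group_def)
qed (simp_all add: isometry_group_def comp_assoc)

definition orbit_of :: "('a \<Rightarrow> 'a) set \<Rightarrow> 'a \<Rightarrow> 'a set" where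
  "orbit_of \<Gamma> x = (\<lambda>g. g x) ` \<Gamma>"

definition discrete_isometries :: "('a::metric_space \<Rightarrow> 'a) set \<Rightarrow> bool" where
  "discrete_isometries \<Gamma> \<longleftrightarrow> (\<forall>x. \<forall>R\<ge>0. finite {g \<in> \<Gamma>. dist x (g x) \<le> R})"

text \<open>
  A sequence of points of the space converges to a boundary point exactly when it is a Gromov
  sequence belonging to that class; the limit set collects the limits of sequences in the orbit.
  It does not depend on \<open>x\<close> for a group of isometries of a Gromov-hyperbolic space.
\<close>

definition limit_set :: "('a::metric_space \<Rightarrow> 'a) set \<Rightarrow> 'a \<Rightarrow> (nat \<Rightarrow> 'a) set set" where
  "limit_set \<Gamma> x = {\<xi> \<in> gromov_boundary. \<exists>u\<in>\<xi>. range u \<subseteq> orbit_of \<Gamma> x}"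

definition non_elementary :: "('a::metric_space \<Rightarrow> 'a) set \<Rightarrow> bool" where
  "non_elementary \<Gamma> \<longleftrightarrow> (\<exists>x. infinite (limit_set \<Gamma> x) \<or> card (limit_set \<Gamma> x) > 2)"

definition torsion_free :: "('g, 'b) monoid_scheme \<Rightarrow> bool" where
  "torsion_free G \<longleftrightarrow>
     (\<forall>g\<in>carrier G. \<forall>n::nat. n > 0 \<longrightarrow> g [^]\<^bsub>G\<^esub> n = \<one>\<^bsub>G\<^esub> \<longrightarrow> g = \<one>\<^bsub>G\<^esub>)"

definition virtually_torsion_free :: "('g, 'b) monoid_scheme \<Rightarrow> bool" where
  "virtually_torsion_free G \<longleftrightarrow>
     (\<exists>H. subgroup H G \<and> finite (rcosets\<^bsub>G\<^esub> H) \<and> torsion_free (G\<lparr>carrier := H\<rparr>))"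

text \<open>For a discrete group the orbit meets every ball in a finite set, so \<^const>\<open>card\<close> is genuine.\<close>

definition critical_exponent :: "('a::metric_space \<Rightarrow> 'a) set \<Rightarrow> 'a \<Rightarrow> ereal" where
  "critical_exponent \<Gamma> x =
     Limsup at_top (\<lambda>T::real. ereal (ln (real (card (orbit_of \<Gamma> x \<inter> ball x T))) / T))"

definition geodesic_lines :: "(real \<Rightarrow> 'a::metric_space) set" where
  "geodesic_lines = {\<gamma>. \<forall>s t. dist (\<gamma> s) (\<gamma> t) = \<bar>s - t\<bar>}"

definition geod_topology :: "(real \<Rightarrow> 'a::metric_space) topology" where
  "geod_topology = topology_generated_by
     {{\<eta> \<in> geodesic_lines. \<forall>t\<in>K. dist (\<gamma> t) (\<eta> t) < \<epsilon>} | \<gamma> K \<epsilon>.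
        \<gamma> \<in> geodesic_lines \<and> compact K \<and> \<epsilon> > 0}"

lemma topspace_geod_topology [simp]: "topspace geod_topology = geodesic_lines"
proof
  show "topspace geod_topology \<subseteq> (geodesic_lines :: (real \<Rightarrow> 'a) set)"
    unfolding geod_topology_def topology_generated_by_topspace by blast
  show "geodesic_lines \<subseteq> topspace (geod_topology :: (real \<Rightarrow> 'a) topology)"
  proof
    fix \<gamma> :: "real \<Rightarrow> 'a"
    assume g: "\<gamma> \<in> geodesic_lines"
    let ?U = "{\<eta> \<in> geodesic_lines. \<forall>t\<in>{}. dist (\<gamma> t) (\<eta> t) < 1}"
    have "openin geod_topology ?U"
      unfolding geod_topology_def
      by (rule topology_generated_by_Basis, rule CollectI, rule exI[of _ \<gamma>],
          rule exI[of _ "{}"], rule exI[of _ 1]) (use g in simp)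
    then show "\<gamma> \<in> topspace geod_topology"
      using openin_subset g by fastforce
  qed
qed

text \<open>The convergence of this topology is uniform convergence on compact sets.\<close>

lemma limitin_geod_topology:
  "limitin geod_topology f \<gamma> F \<longleftrightarrow>
     \<gamma> \<in> geodesic_lines \<and> eventually (\<lambda>i. f i \<in> geodesic_lines) F \<and>
     (\<forall>K. compact K \<longrightarrow> uniform_limit K f \<gamma> F)"
  (is "?lhs \<longleftrightarrow> ?rhs")
proof
  assume L: ?lhs
  then have g: "\<gamma> \<in> geodesic_lines"
    by (auto simp: limitin_def)
  have ev: "eventually (\<lambda>i. f i \<in> U) F" if "openin geod_topology U" "\<gamma> \<in> U" for U
    using L that by (auto simp: limitin_def)
  have "uniform_limit K f \<gamma> F" if K: "compact K" for K
  proof (rule uniform_limitI)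
    fix e :: real
    assume e: "e > 0"
    let ?U = "{\<eta> \<in> geodesic_lines. \<forall>t\<in>K. dist (\<gamma> t) (\<eta> t) < e}"
    have "openin geod_topology ?U"
      unfolding geod_topology_def
      by (rule topology_generated_by_Basis, rule CollectI, rule exI[of _ \<gamma>],
          rule exI[of _ K], rule exI[of _ e]) (use g K e in simp)
    from ev[OF this] have "eventually (\<lambda>i. f i \<in> ?U) F"
      using g e by auto
    then show "eventually (\<lambda>i. \<forall>t\<in>K. dist (f i t) (\<gamma> t) < e) F"
      by eventually_elim (auto simp: dist_commute)
  qed
  moreover have "eventually (\<lambda>i. f i \<in> geodesic_lines) F"
    using ev[OF openin_topspace] g by simp
  ultimately show ?rhs
    using g by blast
next
  assume R: ?rhs
  then have g: "\<gamma> \<in> geodesic_lines" and f: "eventually (\<lambda>i. f i \<in> geodesic_lines) F"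
    and u: "\<And>K. compact K \<Longrightarrow> uniform_limit K f \<gamma> F"
    by auto
  have "\<gamma> \<in> U \<longrightarrow> eventually (\<lambda>i. f i \<in> U) F" if "openin geod_topology U" for U
    using that unfolding geod_topology_def openin_topology_generated_by_iff
  proof induction
    case (Int a b)
    then show ?case by (auto intro: eventually_conj)
  next
    case (UN \<K>)
    show ?case
    proof
      assume "\<gamma> \<in> \<Union>\<K>"
      then obtain k where k: "k \<in> \<K>" "\<gamma> \<in> k" by blast
      with UN.IH have "eventually (\<lambda>i. f i \<in> k) F" by blast
      then show "eventually (\<lambda>i. f i \<in> \<Union>\<K>) F"
        by eventually_elim (use k in blast)
    qed
  next
    case (Basis s)
    then obtain \<eta> K e where s: "s = {\<theta> \<in> geodesic_lines. \<forall>t\<in>K. dist (\<eta> t) (\<theta> t) < e}"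
      and \<eta>: "\<eta> \<in> geodesic_lines" and K: "compact K" by blast
    have cont: "continuous_on K \<zeta>" if "\<zeta> \<in> geodesic_lines" for \<zeta> :: "real \<Rightarrow> 'a"
      unfolding continuous_on_iff
      using that by (auto simp: geodesic_lines_def dist_real_def)
    show ?case
    proof
      assume "\<gamma> \<in> s"
      then have lt: "\<And>t. t \<in> K \<Longrightarrow> dist (\<eta> t) (\<gamma> t) < e"
        by (auto simp: s)
      have "\<exists>d>0. \<forall>t\<in>K. dist (\<eta> t) (\<gamma> t) \<le> e - d"
      proof (cases "K = {}")
        case True
        then show ?thesis by (intro exI[of _ 1]) auto
      next
        case False
        have "continuous_on K (\<lambda>t. dist (\<eta> t) (\<gamma> t))"
          by (intro continuous_on_dist cont \<eta> g)
        from continuous_attains_sup[OF K False this] obtain m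
          where m: "m \<in> K" "\<And>t. t \<in> K \<Longrightarrow> dist (\<eta> t) (\<gamma> t) \<le> dist (\<eta> m) (\<gamma> m)" by blast
        then show ?thesis
          using lt[OF m(1)] by (intro exI[of _ "e - dist (\<eta> m) (\<gamma> m)"]) auto
      qed
      then obtain d where d: "d > 0" "\<And>t. t \<in> K \<Longrightarrow> dist (\<eta> t) (\<gamma> t) \<le> e - d" by blast
      from uniform_limitD[OF u[OF K] d(1)]
      have "eventually (\<lambda>i. \<forall>t\<in>K. dist (f i t) (\<gamma> t) < d) F" .
      with f show "eventually (\<lambda>i. f i \<in> s) F"
      proof eventually_elim
        case (elim i)
        have "dist (\<eta> t) (f i t) < e" if "t \<in> K" for t
          using elim(2) d(2)[OF that] that dist_triangle2[of "\<eta> t" "f i t" "\<gamma> t"] by fastforce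
        with elim(1) show ?case by (simp add: s)
      qed
    qed
  qed simp
  then show ?lhs
    using g by (auto simp: limitin_def)
qed

definition quotient_topology :: "'a topology \<Rightarrow> ('a \<Rightarrow> 'b) \<Rightarrow> 'b topology" where
  "quotient_topology X q =
     topology (\<lambda>U. U \<subseteq> q ` topspace X \<and> openin X {x \<in> topspace X. q x \<in> U})"

lemma openin_quotient_topology:
  "openin (quotient_topology X q) U \<longleftrightarrow>
     U \<subseteq> q ` topspace X \<and> openin X {x \<in> topspace X. q x \<in> U}"
proof -
  have "istopology (\<lambda>U. U \<subseteq> q ` topspace X \<and> openin X {x \<in> topspace X. q x \<in> U})"
    unfolding istopology_def
  proof (intro conjI allI impI; (elim conjE)?)
    fix S T
    assume "openin X {x \<in> topspace X. q x \<in> S}" "openin X {x \<in> topspace X. q x \<in> T}"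
    moreover have "{x \<in> topspace X. q x \<in> S \<inter> T} =
        {x \<in> topspace X. q x \<in> S} \<inter> {x \<in> topspace X. q x \<in> T}" by auto
    ultimately show "openin X {x \<in> topspace X. q x \<in> S \<inter> T}" by auto
  next
    fix \<U>
    assume "\<forall>U\<in>\<U>. U \<subseteq> q ` topspace X \<and> openin X {x \<in> topspace X. q x \<in> U}"
    then have "openin X (\<Union>U\<in>\<U>. {x \<in> topspace X. q x \<in> U})" by blast
    moreover have "{x \<in> topspace X. q x \<in> \<Union>\<U>} = (\<Union>U\<in>\<U>. {x \<in> topspace X. q x \<in> U})" by auto
    ultimately show "openin X {x \<in> topspace X. q x \<in> \<Union>\<U>}" by simp
  qed auto
  then show ?thesis
    by (simp add: quotient_topology_def topology_inverse')
qed

lemma topspace_quotient_topology [simp]: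
  "topspace (quotient_topology X q) = q ` topspace X"
proof -
  have "{x \<in> topspace X. q x \<in> q ` topspace X} = topspace X" by auto
  then have "openin (quotient_topology X q) (q ` topspace X)"
    by (simp add: openin_quotient_topology)
  then show ?thesis
    by (metis openin_quotient_topology openin_subset openin_topspace subset_antisym)
qed

lemma quotient_map_quotient_topology: "quotient_map X (quotient_topology X q) q"
  by (auto simp: quotient_map_def openin_quotient_topology)

definition line_orbit :: "('a \<Rightarrow> 'a) set \<Rightarrow> (real \<Rightarrow> 'a) \<Rightarrow> (real \<Rightarrow> 'a) set" where
  "line_orbit \<Gamma> \<gamma> = (\<lambda>g. g \<circ> \<gamma>) ` \<Gamma>"

definition geod_quotient :: "('a::metric_space \<Rightarrow> 'a) set \<Rightarrow> (real \<Rightarrow> 'a) set topology" where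
  "geod_quotient \<Gamma> = quotient_topology geod_topology (line_orbit \<Gamma>)"

definition geod_flow :: "real \<Rightarrow> (real \<Rightarrow> 'a) \<Rightarrow> (real \<Rightarrow> 'a)" where
  "geod_flow t \<gamma> = (\<lambda>s. \<gamma> (s + t))"

text \<open>The induced flow sends the orbit of a line to the orbit of the shifted line.\<close>

definition quotient_flow :: "real \<Rightarrow> (real \<Rightarrow> 'a) set \<Rightarrow> (real \<Rightarrow> 'a) set" where
  "quotient_flow t A = geod_flow t ` A"

lemma quotient_flow_line_orbit:
  "quotient_flow t (line_orbit \<Gamma> \<gamma>) = line_orbit \<Gamma> (geod_flow t \<gamma>)"
  by (simp add: quotient_flow_def line_orbit_def geod_flow_def image_image comp_def)

definition dyn_dist :: "('y \<Rightarrow> 'y \<Rightarrow> real) \<Rightarrow> ('y \<Rightarrow> 'y) \<Rightarrow> nat \<Rightarrow> 'y \<Rightarrow> 'y \<Rightarrow> real" where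
  "dyn_dist \<rho> T n y y' = Max ((\<lambda>i. \<rho> ((T ^^ i) y) ((T ^^ i) y')) ` {..<n})"

definition covering_number :: "'y set \<Rightarrow> ('y \<Rightarrow> 'y \<Rightarrow> real) \<Rightarrow> 'y set \<Rightarrow> real \<Rightarrow> nat" where
  "covering_number Y \<rho> K r =
     (LEAST k. \<exists>C. C \<subseteq> Y \<and> finite C \<and> card C = k \<and> K \<subseteq> (\<Union>c\<in>C. {y \<in> Y. \<rho> c y < r}))"

text \<open>
  Meant for metrizable \<open>Y\<close> and continuous \<open>T\<close>: then the covering numbers of compact sets are finite
  (so \<open>LEAST\<close> is attained) and the limit as \<open>r\<close> tends to 0 exists by monotonicity. The values \<open>n = 0\<close>
  and \<open>K = {}\<close> (where \<open>ln 0 = 0\<close>) do not affect the result on a nonempty space.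
\<close>

definition topological_entropy :: "'y topology \<Rightarrow> ('y \<Rightarrow> 'y) \<Rightarrow> ereal" where
  "topological_entropy Y T =
     (INF \<rho> \<in> {\<rho>. Metric_space (topspace Y) \<rho> \<and> Metric_space.mtopology (topspace Y) \<rho> = Y}.
        SUP K \<in> {K. compactin Y K}.
          Lim (at_right 0) (\<lambda>r::real.
            limsup (\<lambda>n. ereal (ln (real (covering_number (topspace Y) (dyn_dist \<rho> T n) K r)) / real n))))"

end

theory Submission
  imports Defs "HOL-Real_Asymp.Real_Asymp"
begin

text \<open>
  Fix \<open>h\<close> below the critical exponent. A discrete non-elementary group has no fixed direction at
  infinity, so a finite set of elements suffices to turn any two elements into a product without
  backtracking. Pigeonholing the orbit points of a thin annulus by the direction of the element and
  of its inverse then yields finite sets \<open>S\<close> of elements of length about \<open>L\<close>, with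
  \<open>card S \<ge> exp (h L)\<close>, such that all products of elements of \<open>S\<close> are quasi-geodesic with constants
  independent of \<open>L\<close>. Every word in \<open>S\<close> is followed by a geodesic line that stays near the orbit,
  hence in a fixed compact part of the quotient.

  Two such lines that stay close in the quotient for time \<open>n\<close> are close in the space itself on every
  window of length \<open>W\<close>, after applying a group element that may change from window to window. There
  are boundedly many choices for each change, so a dynamical ball contains at most \<open>N ^ (n / W + 1)\<close>
  words, and the entropy is at least \<open>h - ln N / W\<close>. Every \<open>W\<close> is
  allowed once the radius is small enough.
\<close>

text \<open>The entropy is an infimum over all compatible metrics, so nothing quantitative about a
  metric on the quotient may enter. Closeness there is used only through a Lebesgue number: near a
  compact set it forces two lines to lie within 1 of each other on a prescribed window, up to a
  group element. That distance is fixed, not small, and elements may move points by little or fix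
  them, so the tracking element is not determined; the possible changes are counted instead. The
  order of choices makes the count harmless. The backtracking constant \<open>C\<close> is
  independent of the length \<open>L\<close> of the generators, so \<open>L\<close> and the
  separation of the generators may be taken large compared with it. The number \<open>N\<close> of
  possible changes depends on how far the lines stray from the orbit, hence on \<open>L\<close>, but
  not on \<open>W\<close>, so \<open>W\<close> can grow while the set of generators and the compact
  set stay fixed. Only the radius depends on \<open>W\<close>, which is allowed because the entropy
  takes the limit as the radius tends to 0.\<close>

section \<open>Gromov products and chains\<close>

text \<open>The notation \<open>inv\<close> is taken by HOL-Algebra.\<close>

abbreviation (input) ginv :: "('a \<Rightarrow> 'b) \<Rightarrow> 'b \<Rightarrow> 'a" where "ginv \<equiv> inv_into UNIV"

lemma gromov_product_commute: "gromov_product w y z = gromov_product w z y"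
  by (simp add: gromov_product_def dist_commute)

lemma gromov_product_nonneg: "0 \<le> gromov_product w y z"
  using dist_triangle3[of y z w] by (simp add: gromov_product_def)

lemma gromov_product_le_dist: "gromov_product w y z \<le> dist w y"
  using dist_triangle[of w z y] by (simp add: gromov_product_def)

lemma gromov_product_swap: "gromov_product y w z = dist w y - gromov_product w y z"
  by (simp add: gromov_product_def dist_commute field_simps)

lemma gromov_product_basepoint_self: "gromov_product w w z = 0"
  by (simp add: gromov_product_def)

lemma gromov_product_self: "gromov_product w z z = dist w z"
  by (simp add: gromov_product_def)

lemma gromov_product_Lipschitz: "gromov_product w y z \<le> gromov_product w y' z + dist y y'"
  using dist_triangle[of w y y'] dist_triangle[of y' z y]
  by (simp add: gromov_product_def dist_commute field_simps)

lemma gromov_product_Lipschitz_basepoint: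
  "gromov_product w y z \<le> gromov_product w' y z + dist w w'"
  using dist_triangle[of w y w'] dist_triangle[of w z w']
  by (simp add: gromov_product_def field_simps)

locale hyperbolic_space =
  fixes space_type :: "'a::metric_space itself" and \<delta> :: real
  assumes delta_nonneg: "0 \<le> \<delta>"
    and hyperbolic: "min (gromov_product w y u) (gromov_product w u z) - \<delta>
      \<le> gromov_product w (y::'a) z"
begin

text \<open>The four-point inequality in the form used throughout: a point seen from
  \<open>w\<close> in the direction of \<open>y\<close> inherits the separation of \<open>y\<close>
  from \<open>z\<close>, at the cost of one \<open>\<delta>\<close>.\<close>

lemma separated_transfer:
  fixes w y z u :: 'a
  assumes "gromov_product w y z \<le> c" "c + \<delta> < gromov_product w y u"
  shows "gromov_product w u z \<le> c + \<delta>"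
  using hyperbolic[of w y u z] assms by linarith

context
  fixes p :: "nat \<Rightarrow> 'a" and C :: real
  assumes angle: "\<And>i. gromov_product (p (Suc i)) (p i) (p (Suc (Suc i))) \<le> C"
    and long: "\<And>i. 2 * C + 3 * \<delta> + 1 \<le> dist (p i) (p (Suc i))"
begin

text \<open>From the new vertex the start of the chain lies in the direction of the preceding
  vertex, because the induction hypothesis makes their product exceed \<open>C + \<delta>\<close>.
  Each step transfers the local bound \<open>C\<close>, not the bound of the previous step, so the
  error does not accumulate.\<close>

lemma chain_angle_left: "gromov_product (p (Suc (i + k))) (p i) (p (Suc (Suc (i + k)))) \<le> C + \<delta>"
proof (induction k)
  case 0
  then show ?case using angle[of i] delta_nonneg by simp
next
  case (Suc k)
  let ?w = "p (Suc (Suc (i + k)))"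
  have "gromov_product ?w (p (Suc (i + k))) (p i)
      = dist (p (Suc (i + k))) ?w - gromov_product (p (Suc (i + k))) (p i) ?w"
    by (metis gromov_product_swap gromov_product_commute)
  also have "\<dots> > C + \<delta>" using Suc.IH long[of "Suc (i + k)"] delta_nonneg by linarith
  finally have "C + \<delta> < gromov_product ?w (p (Suc (i + k))) (p i)" .
  from separated_transfer[OF angle this] show ?case by simp
qed

lemma chain_angle_right: "gromov_product (p (Suc i)) (p i) (p (Suc (Suc (i + k)))) \<le> C + \<delta>"
proof (induction k arbitrary: i)
  case 0
  then show ?case using angle[of i] delta_nonneg by simp
next
  case (Suc k)
  let ?w = "p (Suc i)" and ?z = "p (Suc (Suc (Suc (i + k))))"
  have "gromov_product ?w (p (Suc (Suc i))) ?z
      = dist ?w (p (Suc (Suc i))) - gromov_product (p (Suc (Suc i))) ?w ?z"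
    by (metis gromov_product_swap dist_commute)
  also have "\<dots> > C + \<delta>" using Suc.IH[of "Suc i"] long[of "Suc i"] delta_nonneg by simp
  finally have "C + \<delta> < gromov_product ?w (p (Suc (Suc i))) ?z" .
  moreover have "gromov_product ?w (p (Suc (Suc i))) (p i) \<le> C"
    using angle[of i] by (simp add: gromov_product_commute)
  ultimately have "gromov_product ?w ?z (p i) \<le> C + \<delta>" by (rule separated_transfer[rotated])
  then show ?case by (simp add: gromov_product_commute)
qed

text \<open>At an interior vertex the start and the end of the chain are brought in by one transfer
  each. The second one needs
  \<open>dist (p k) (p (Suc k)) - (C + \<delta>) > C + 2 * \<delta>\<close>, which is the origin of
  the constant in \<open>long\<close>.\<close>

lemma chain_angle:
  assumes "i \<le> k" "k \<le> n"
  shows "gromov_product (p k) (p i) (p n) \<le> C + 2 * \<delta>"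
proof -
  have C: "0 \<le> C" using angle[of 0] gromov_product_nonneg order_trans by blast
  consider "i = k" | "k = n" | "i < k" "Suc k = n" | "i < k" "Suc k < n" using assms by linarith
  then show ?thesis
  proof cases
    case 1 then show ?thesis using C delta_nonneg by (simp add: gromov_product_basepoint_self)
  next
    case 2 then show ?thesis using C delta_nonneg
      by (simp add: gromov_product_basepoint_self gromov_product_commute[of "p n" "p i" "p n"])
  next
    case 3
    then obtain j where "k = Suc (i + j)" by (metis less_iff_Suc_add)
    then show ?thesis using chain_angle_left[of i j] 3 delta_nonneg by simp
  next
    case 4
    then obtain j l where j: "k = Suc (i + j)" and l: "n = Suc (Suc (k + l))"
      by (metis less_iff_Suc_add add_Suc)
    have a: "gromov_product (p k) (p (Suc k)) (p i) \<le> C + \<delta>"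
      using chain_angle_left[of i j] j by (simp add: gromov_product_commute)
    have "gromov_product (p k) (p (Suc k)) (p n)
        = dist (p k) (p (Suc k)) - gromov_product (p (Suc k)) (p k) (p n)"
      by (metis gromov_product_swap dist_commute)
    also have "\<dots> > C + \<delta> + \<delta>"
    proof (cases l)
      case 0
      then show ?thesis using angle[of k] long[of k] l delta_nonneg by simp
    next
      case (Suc m)
      then show ?thesis using chain_angle_right[of k l] long[of k] l delta_nonneg by simp
    qed
    finally have "gromov_product (p k) (p n) (p i) \<le> C + \<delta> + \<delta>"
      by (rule separated_transfer[OF a])
    then show ?thesis by (simp add: gromov_product_commute)
  qed
qed

end

text \<open>Seen from \<open>a\<close>, both \<open>y\<close> and \<open>p\<close> point toward
  \<open>b\<close>, up to the depths \<open>u\<close> and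
  \<open>dist a p - gromov_product p a b\<close>. Their mutual product is at least the smaller depth
  minus \<open>\<delta>\<close>, which bounds their distance.\<close>

lemma dist_geodesic_point_le:
  fixes a b y p :: 'a
  assumes u: "dist a y = u" "dist y b = dist a b - u"
  shows "dist y p \<le> \<bar>u - dist a p\<bar> + 2 * gromov_product p a b + 2 * \<delta>"
proof -
  have yb: "gromov_product a y b = u" using u by (simp add: gromov_product_def)
  have bp: "gromov_product a b p = dist a p - gromov_product p a b"
    using gromov_product_swap[of p a b] gromov_product_commute[of a b p] by linarith
  have "dist y p = dist a p + u - 2 * gromov_product a y p"
    using u by (simp add: gromov_product_def field_simps)
  moreover have "min u (dist a p - gromov_product p a b) - \<delta> \<le> gromov_product a y p"
    using hyperbolic[of a y b p] yb bp by simp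
  ultimately show ?thesis using gromov_product_nonneg[of p a b] by linarith
qed

end

section \<open>Discrete groups of isometries\<close>

text \<open>The group laws are stated with \<open>\<circ>\<close> and \<open>inv_into UNIV\<close>,
  so that elements can be applied to points directly. Discreteness is kept at the base point
  \<open>x\<close>, from which all lengths and products are measured.\<close>

locale discrete_hyperbolic_group = hyperbolic_space "TYPE('a::metric_space)" \<delta> for \<delta> +
  fixes \<Gamma> :: "('a::metric_space \<Rightarrow> 'a) set" and x :: 'a
  assumes id_mem [simp, intro]: "id \<in> \<Gamma>"
    and comp_mem [simp, intro]: "\<lbrakk>g \<in> \<Gamma>; h \<in> \<Gamma>\<rbrakk> \<Longrightarrow> g \<circ> h \<in> \<Gamma>"
    and inv_mem [simp, intro]: "g \<in> \<Gamma> \<Longrightarrow> ginv g \<in> \<Gamma>"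
    and surj: "g \<in> \<Gamma> \<Longrightarrow> surj g"
    and isom: "g \<in> \<Gamma> \<Longrightarrow> dist (g y) (g z) = dist y z"
    and finite_ball: "finite {g \<in> \<Gamma>. dist x (g x) \<le> R}"
begin

lemma inj: "g \<in> \<Gamma> \<Longrightarrow> inj g"
  by (rule injI) (metis isom dist_eq_0_iff)

lemma apply_inv [simp]: "g \<in> \<Gamma> \<Longrightarrow> g (ginv g y) = y"
  by (simp add: surj surj_f_inv_f)

lemma inv_apply [simp]: "g \<in> \<Gamma> \<Longrightarrow> ginv g (g y) = y"
  by (simp add: inj inv_f_f)

lemma inv_inv [simp]: "g \<in> \<Gamma> \<Longrightarrow> ginv (ginv g) = g"
  by (simp add: inj surj bijI inv_inv_eq)

lemma dist_inv: "g \<in> \<Gamma> \<Longrightarrow> dist (ginv g y) z = dist y (g z)"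
  by (metis apply_inv isom)

lemma inv_comp: "\<lbrakk>g \<in> \<Gamma>; h \<in> \<Gamma>\<rbrakk> \<Longrightarrow> ginv (g \<circ> h) = ginv h \<circ> ginv g"
  by (simp add: o_inv_distrib inj surj bijI)

lemma funpow_mem [simp, intro]: "g \<in> \<Gamma> \<Longrightarrow> g ^^ n \<in> \<Gamma>"
  by (induction n) auto

definition len :: "('a \<Rightarrow> 'a) \<Rightarrow> real" where "len g = dist x (g x)"

definition gp :: "('a \<Rightarrow> 'a) \<Rightarrow> ('a \<Rightarrow> 'a) \<Rightarrow> real" where
  "gp g h = gromov_product x (g x) (h x)"

lemma len_nonneg: "0 \<le> len g" by (simp add: len_def)

lemma finite_len: "finite {g \<in> \<Gamma>. len g \<le> R}"
  using finite_ball by (simp add: len_def)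

lemma gp_commute: "gp g h = gp h g" by (simp add: gp_def gromov_product_commute)

lemma gp_nonneg: "0 \<le> gp g h" by (simp add: gp_def gromov_product_nonneg)

lemma gp_le_len: "gp g h \<le> len g" by (simp add: gp_def len_def gromov_product_le_dist)

lemma gp_le_len': "gp g h \<le> len h" by (metis gp_commute gp_le_len)

lemma gp_hyperbolic: "min (gp g k) (gp k h) - \<delta> \<le> gp g h"
  by (simp only: gp_def hyperbolic)

lemma gp_transfer: "\<lbrakk>gp g h \<le> c; c + \<delta> < gp g k\<rbrakk> \<Longrightarrow> gp k h \<le> c + \<delta>"
  by (simp only: gp_def separated_transfer)

lemma len_inv [simp]: "g \<in> \<Gamma> \<Longrightarrow> len (ginv g) = len g"
  by (simp add: len_def dist_inv dist_commute[of x "ginv g x"])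

lemma dist_orbit: "\<lbrakk>g \<in> \<Gamma>; h \<in> \<Gamma>\<rbrakk> \<Longrightarrow> dist (g x) (h x) = len (ginv g \<circ> h)"
  by (simp add: len_def dist_inv[of "ginv g", simplified] dist_commute)
     (metis dist_inv dist_commute)

text \<open>The isometry \<open>ginv g\<close> carries the corner at \<open>g x\<close> between
  \<open>x\<close> and \<open>g (h x)\<close> to the corner at \<open>x\<close> between
  \<open>ginv g x\<close> and \<open>h x\<close>. So \<open>gp (ginv g) h\<close> measures the
  backtracking in \<open>g \<circ> h\<close>.\<close>

lemma len_comp: "g \<in> \<Gamma> \<Longrightarrow> len (g \<circ> h) = len g + len h - 2 * gp (ginv g) h"
  using len_inv[of g] by (simp add: gp_def gromov_product_def len_def dist_inv field_simps)

lemma len_comp_le: "g \<in> \<Gamma> \<Longrightarrow> len (g \<circ> h) \<le> len g + len h"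
  using len_comp[of g h] gp_nonneg[of "ginv g" h] by simp

lemma len_comp_ge: "g \<in> \<Gamma> \<Longrightarrow> len g - len h \<le> len (g \<circ> h)"
  using len_comp[of g h] gp_le_len'[of "ginv g" h] by simp

lemma len_comp_ge': "g \<in> \<Gamma> \<Longrightarrow> len h - len g \<le> len (g \<circ> h)"
  using len_comp[of g h] gp_le_len[of "ginv g" h] by simp

lemma gp_comp: "g \<in> \<Gamma> \<Longrightarrow> gp g (g \<circ> h) = len g - gp (ginv g) h"
  using len_inv[of g] by (simp add: gp_def gromov_product_def len_def dist_inv isom field_simps)

lemma gp_inv_comp: "g \<in> \<Gamma> \<Longrightarrow> gp (ginv g) (ginv g \<circ> h) = len g - gp g h"
  using gp_comp[of "ginv g" h] by simp

text \<open>Applying \<open>u\<close> to both points amounts to moving the base point by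
  \<open>len u\<close>.\<close>

lemma gp_translate:
  assumes u: "u \<in> \<Gamma>"
  shows "gp g h - len u \<le> gp (u \<circ> g) (u \<circ> h)" "gp (u \<circ> g) (u \<circ> h) \<le> gp g h + len u"
proof -
  have "gp (u \<circ> g) (u \<circ> h) = gromov_product (ginv u x) (g x) (h x)"
    using u by (simp add: gp_def gromov_product_def dist_inv isom)
  then show "gp g h - len u \<le> gp (u \<circ> g) (u \<circ> h)" "gp (u \<circ> g) (u \<circ> h) \<le> gp g h + len u"
    using gromov_product_Lipschitz_basepoint[of x "g x" "h x" "ginv u x"]
      gromov_product_Lipschitz_basepoint[of "ginv u x" "g x" "h x" x] len_inv[OF u]
    by (simp_all add: gp_def len_def dist_commute)
qed

lemma gp_comp_right:
  assumes "h \<in> \<Gamma>"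
  shows "gp g (h \<circ> f) \<le> gp g h + len f"
  using gromov_product_Lipschitz[of x "h (f x)" "g x" "h x"] assms
  by (simp add: gp_def len_def isom gromov_product_commute dist_commute)

lemma gp_comp_left: "u \<in> \<Gamma> \<Longrightarrow> gp (u \<circ> g) h \<le> gp g (ginv u \<circ> h) + len u"
  using gp_translate(2)[of u g "ginv u \<circ> h"] by (simp add: fun_eq_iff comp_def gp_def)

end

section \<open>Finitely many elements that prevent backtracking\<close>

context discrete_hyperbolic_group
begin

lemma gromov_product_isom:
  "g \<in> \<Gamma> \<Longrightarrow> gromov_product (g w) (g y) (g z) = gromov_product w y z"
  by (simp add: gromov_product_def isom)

text \<open>The points \<open>(a ^^ i) x\<close> form a chain whose corners are all copies of the
  one between \<open>ginv a x\<close> and \<open>a x\<close>.\<close>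

lemma gp_powers:
  assumes a: "a \<in> \<Gamma>" "gp (ginv a) a \<le> C" "2 * C + 3 * \<delta> + 1 \<le> len a"
  shows "gp (ginv (a ^^ k)) (a ^^ m) \<le> C + 2 * \<delta>"
proof -
  define p where "p i = (a ^^ i) x" for i
  have pI: "(a ^^ k) (ginv (a ^^ k) x) = p 0" for k
    using a by (simp add: p_def)
  have pS: "(a ^^ Suc i) (ginv a x) = p i" for i
    using a by (simp add: p_def funpow_swap1)
  have pA: "(a ^^ k) ((a ^^ m) x) = p (k + m)" for k m
    by (simp add: p_def funpow_add)
  have "gromov_product (p (Suc i)) (p i) (p (Suc (Suc i))) \<le> C" for i
  proof -
    have "gromov_product ((a ^^ Suc i) x) ((a ^^ Suc i) (ginv a x)) ((a ^^ Suc i) (a x)) \<le> C"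
      by (subst gromov_product_isom) (use a in \<open>auto simp: gp_def\<close>)
    then show ?thesis using pS[of i] pA[of "Suc i" 1] by (simp add: p_def funpow_swap1)
  qed
  moreover have "2 * C + 3 * \<delta> + 1 \<le> dist (p i) (p (Suc i))" for i
    using a(3) isom[of "a ^^ i" x "a x"] a(1) by (simp add: p_def len_def funpow_swap1)
  ultimately have "gromov_product (p k) (p 0) (p (k + m)) \<le> C + 2 * \<delta>"
    by (rule chain_angle) auto
  moreover have "gromov_product (p k) (p 0) (p (k + m)) = gp (ginv (a ^^ k)) (a ^^ m)"
    using gromov_product_isom[of "a ^^ k" x "ginv (a ^^ k) x" "(a ^^ m) x"] a(1)
    by (simp add: gp_def p_def funpow_add)
  ultimately show ?thesis by simp
qed

text \<open>
  The \<open>h n\<close> would converge to a boundary point fixed by the group. A long \<open>A\<close> among the \<open>a k\<close> is then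
  loxodromic with this point as repelling point, and every \<open>w\<close> pointing away from it is \<open>u \<circ> A ^^ m\<close>
  with \<open>u\<close> in a finite set. Applied to more elements \<open>A ^^ i \<circ> b l\<close> than there are such \<open>u\<close>, this makes
  two of them point in the same direction, although they do not.
\<close>

lemma no_fixed_direction:
  assumes h: "\<And>n. h n \<in> \<Gamma>"
    and fixed: "\<And>n f. \<lbrakk>f \<in> \<Gamma>; len f \<le> real n\<rbrakk> \<Longrightarrow> real n - \<delta> \<le> gp (h n) (f \<circ> h n)"
    and ab: "\<And>k. a k \<in> \<Gamma>" "\<And>k. b k \<in> \<Gamma>"
    and unbounded: "\<And>M. \<exists>k. M \<le> len (a k)" "\<And>M. \<exists>k. M \<le> len (b k)"
    and far: "\<And>k n. gp (a k) (h n) \<le> C" "\<And>k n. gp (b k) (h n) \<le> C"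
      "\<And>k l. gp (a k) (b l) \<le> C"
  shows False
proof -
  have C: "0 \<le> C" using far(1) gp_nonneg order_trans by blast
  note \<delta> = delta_nonneg
  \<comment> \<open>If \<open>g\<close> points away from \<open>h n\<close>, its inverse points
    toward \<open>h n\<close>: the element \<open>ginv g \<circ> h n\<close> shares the direction of
    \<open>ginv g\<close> up to \<open>len g - c\<close>, and by \<open>fixed\<close> it also shares
    that of \<open>h n\<close>.\<close>
  have toward: "len g - c - 2 * \<delta> \<le> gp (ginv g) (h n)"
    if g: "g \<in> \<Gamma>" "gp g (h n) \<le> c" "0 \<le> c" "len g \<le> n" for g n c
    using gp_inv_comp[of g "h n"] fixed[of "ginv g" n] gp_hyperbolic[of "ginv g" "ginv g \<circ> h n" "h n"]
      gp_commute[of "h n" "ginv g \<circ> h n"] g \<delta> by simp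
  obtain k0 where k0: "4 * C + 20 * \<delta> + 10 \<le> len (a k0)" using unbounded(1) by blast
  define A where "A = a k0"
  have A: "A \<in> \<Gamma>" "4 * C + 20 * \<delta> + 10 \<le> len A" "\<And>n. gp A (h n) \<le> C" "\<And>l. gp A (b l) \<le> C"
    using k0 ab far by (auto simp: A_def)
  define C2 where "C2 = C + 3 * \<delta>"
  have "gp (ginv A) A \<le> C + \<delta>"
  proof -
    obtain n :: nat where n: "len A \<le> n" using real_arch_simple by blast
    have "gp (h n) A \<le> C" using A(3) by (simp add: gp_commute)
    moreover have "C + \<delta> < gp (h n) (ginv A)"
      using toward[OF A(1) A(3) C n] A(2) C \<delta> by (simp add: gp_commute)
    ultimately show ?thesis by (rule gp_transfer)
  qed
  then have P: "gp (ginv (A ^^ k)) (A ^^ m) \<le> C2" for k m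
    using gp_powers[OF A(1), of "C + \<delta>" k m] A(2) C \<delta> by (simp add: C2_def)
  have len_add: "len (A ^^ k) + len (A ^^ m) - 2 * C2 \<le> len (A ^^ (k + m))" for k m
    using len_comp[of "A ^^ k" "A ^^ m"] P[of k m] A(1) by (simp add: funpow_add)
  have len_Suc: "len (A ^^ m) + 1 \<le> len (A ^^ Suc m)" for m
    using len_add[of 1 m] A(2) C \<delta> by (simp add: C2_def)
  have len_Suc_le: "len (A ^^ Suc m) \<le> len (A ^^ m) + len A" for m
    using len_comp_le[OF A(1), of "A ^^ m"] by simp
  have len_ge: "real m \<le> len (A ^^ m)" for m
  proof (induction m)
    case (Suc m) then show ?case using len_Suc[of m] by (simp del: funpow.simps)
  qed (simp add: len_nonneg)
  have ex_pow: "\<exists>m. len (A ^^ m) \<le> v \<and> v \<le> len (A ^^ m) + len A" if "0 \<le> v" for v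
  proof -
    obtain n :: nat where "v < n" using reals_Archimedean2 by blast
    then have ex: "v < len (A ^^ n)" using len_ge[of n] by simp
    define m where "m = (LEAST m. v < len (A ^^ m))"
    have m: "v < len (A ^^ m)" unfolding m_def by (rule LeastI, rule ex)
    then have "m \<noteq> 0" using that by (auto simp: len_def intro: Nat.gr0I)
    then obtain j where j: "m = Suc j" by (cases m) auto
    then have "\<not> v < len (A ^^ j)" unfolding m_def by (metis lessI not_less_Least m_def)
    then show ?thesis using m len_Suc_le[of j] j by (intro exI[of _ j]) auto
  qed
  have gp_pow: "min (len (A ^^ m)) (len (A ^^ m')) - C2 \<le> gp (A ^^ m) (A ^^ m')" for m m'
  proof -
    have *: "len (A ^^ m) - C2 \<le> gp (A ^^ m) (A ^^ m')" if "m \<le> m'" for m m'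
      using gp_comp[of "A ^^ m" "A ^^ (m' - m)"] P[of m "m' - m"] A(1) that
      by (simp flip: funpow_add)
    show ?thesis
      using *[of m m'] *[of m' m] by (cases "m \<le> m'") (auto simp: gp_commute)
  qed
  have gp_A_pow: "len A - C2 \<le> gp A (A ^^ m)" if "1 \<le> m" for m
    using gp_comp[of A "A ^^ (m - 1)"] P[of 1 "m - 1"] A(1) that
    by (cases m) auto
  have lenA: "len A - C2 \<le> len (A ^^ m)" if "1 \<le> m" for m
    using gp_A_pow[OF that] gp_le_len'[of A "A ^^ m"] by linarith
  have gp_id: "gp id g = 0" for g using gp_le_len[of id g] gp_nonneg[of id g] by (simp add: len_def)
  have far_pow: "gp (A ^^ m) g \<le> C + \<delta>" if "gp A g \<le> C" for m g
  proof (cases "m = 0")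
    case True
    then show ?thesis using gp_id C \<delta> by simp
  next
    case False
    then have "C + \<delta> < gp A (A ^^ m)" using gp_A_pow[of m] A(2) C \<delta> by (simp add: C2_def)
    with that show ?thesis by (rule gp_transfer)
  qed
  have inv_pow_b: "gp (ginv (A ^^ i)) (b l) \<le> C + \<delta>" if "1 \<le> i" for i l
  proof -
    obtain n :: nat where n: "len (A ^^ i) \<le> n" using real_arch_simple by blast
    have "len (A ^^ i) - (C + \<delta>) - 2 * \<delta> \<le> gp (ginv (A ^^ i)) (h n)"
      by (rule toward) (use A far_pow C \<delta> n in auto)
    then have "C + \<delta> < gp (h n) (ginv (A ^^ i))"
      using lenA[OF that] A(2) C \<delta> by (simp add: C2_def gp_commute)
    moreover have "gp (h n) (b l) \<le> C" using far(2) by (simp add: gp_commute)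
    ultimately show ?thesis by (rule gp_transfer[rotated])
  qed
  have pow_b: "C + 3 * \<delta> < gp (A ^^ i) (A ^^ i \<circ> b l)" if "1 \<le> i" for i l
    using gp_comp[of "A ^^ i" "b l"] inv_pow_b[OF that, of l] lenA[OF that] A C \<delta>
    by (simp add: C2_def)
  have far_w: "gp (A ^^ i \<circ> b l) (h n) \<le> C + 2 * \<delta>" for i l n
  proof (cases "i = 0")
    case True
    then show ?thesis using far(2)[of l n] \<delta> by simp
  next
    case False
    then have "C + \<delta> + \<delta> < gp (A ^^ i) (A ^^ i \<circ> b l)" using pow_b[of i l] \<delta> by simp
    from gp_transfer[OF far_pow[OF A(3)] this, of n] show ?thesis by linarith
  qed
  define D where "D = len A + 2 * C + 12 * \<delta>"
  \<comment> \<open>Both \<open>w\<close> and a power of \<open>A\<close> of comparable length have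
    inverses pointing toward \<open>h n\<close> for almost their whole length, so almost everything
    cancels in \<open>w \<circ> ginv (A ^^ m)\<close>.\<close>
  have factor: "\<exists>m. len (A ^^ i \<circ> b l) \<le> len (A ^^ m) + len A
      \<and> len ((A ^^ i \<circ> b l) \<circ> ginv (A ^^ m)) \<le> D" for i l
  proof -
    define w where "w = A ^^ i \<circ> b l"
    have w: "w \<in> \<Gamma>" using A ab by (simp add: w_def)
    obtain m where m: "len (A ^^ m) \<le> len w" "len w \<le> len (A ^^ m) + len A"
      using ex_pow[OF len_nonneg[of w]] by blast
    obtain n :: nat where n: "len w \<le> n" using real_arch_simple by blast
    have 1: "len w - (C + 2 * \<delta>) - 2 * \<delta> \<le> gp (ginv w) (h n)"
      by (rule toward) (use w far_w C \<delta> n in \<open>auto simp: w_def\<close>)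
    have 2: "len (A ^^ m) - (C + \<delta>) - 2 * \<delta> \<le> gp (ginv (A ^^ m)) (h n)"
      by (rule toward) (use A far_pow C \<delta> n m in auto)
    have "len (w \<circ> ginv (A ^^ m)) = len w + len (A ^^ m) - 2 * gp (ginv w) (ginv (A ^^ m))"
      using len_comp[OF w, of "ginv (A ^^ m)"] A by simp
    then have "len (w \<circ> ginv (A ^^ m)) \<le> D"
      using 1 2 gp_hyperbolic[of "ginv w" "h n" "ginv (A ^^ m)"] m gp_commute[of "h n"] \<delta>
      by (simp add: D_def)
    then show ?thesis using m(2) by (auto simp: w_def)
  qed
  define U where "U = {u \<in> \<Gamma>. len u \<le> D}"
  define N where "N = card U"
  have finU: "finite U" unfolding U_def by (rule finite_len)
  \<comment> \<open>There are \<open>N + 1\<close> exponents for \<open>N\<close> possible factors.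
    The length of \<open>b l\<close> is chosen so that two products with the same factor agree far
    beyond the length of every \<open>A ^^ i\<close> with \<open>i \<le> N\<close>.\<close>
  obtain l where l: "(2 * N + 1) * len A + 2 * C + C2 + D + 4 * \<delta> + 1 \<le> len (b l)"
    using unbounded(2) by blast
  obtain m where m: "\<And>i. len (A ^^ i \<circ> b l) \<le> len (A ^^ m i) + len A"
      "\<And>i. len ((A ^^ i \<circ> b l) \<circ> ginv (A ^^ m i)) \<le> D"
    using factor[of _ l] by metis
  define u where "u i = (A ^^ i \<circ> b l) \<circ> ginv (A ^^ m i)" for i
  have uU: "u ` {..N} \<subseteq> U" using m A ab by (auto simp: U_def u_def)
  have "card (u ` {..N}) < card {..N}" using card_mono[OF finU uU] by (simp add: N_def)
  then have "\<not> inj_on u {..N}" by (rule pigeonhole)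
  then obtain i j where ij: "i < j" "j \<le> N" "u i = u j"
    unfolding inj_on_def by (metis atMost_iff linorder_neqE_nat order_less_imp_le)
  have u: "u i \<in> \<Gamma>" "len (u i) \<le> D" using uU ij by (auto simp: U_def)
  have w_eq: "A ^^ i \<circ> b l = u i \<circ> A ^^ m i" for i
    using A by (auto simp: u_def fun_eq_iff)
  have len_pow_le: "len (A ^^ i) \<le> i * len A" for i
  proof (induction i)
    case (Suc i) then show ?case using len_Suc_le[of i] by (simp add: algebra_simps del: funpow.simps)
  qed (simp add: len_def)
  have iN: "len (A ^^ i) \<le> N * len A" if "i \<le> N" for i
    using len_pow_le[of i] that len_nonneg[of A] mult_right_mono[of i N "len A"] by linarith
  have mi: "len (b l) - N * len A - len A \<le> len (A ^^ m i)" if "i \<le> N" for i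
    using m(1)[of i] len_comp_ge'[of "A ^^ i" "b l"] iN[OF that] A(1) by simp
  \<comment> \<open>The common factor forces a long common direction. Once \<open>A ^^ i\<close> is
    cancelled, however, one of the two elements points along \<open>A\<close> while the other is
    \<open>b l\<close>, which does not.\<close>
  have "len (b l) - N * len A - len A - C2 - D \<le> gp (u i \<circ> A ^^ m i) (u i \<circ> A ^^ m j)"
    using gp_translate(1)[OF u(1), of "A ^^ m i" "A ^^ m j"] gp_pow[of "m i" "m j"] mi[of i] mi[of j] ij u(2)
    by simp
  also have "\<dots> = gp (A ^^ i \<circ> b l) (A ^^ j \<circ> b l)" using w_eq[of i] w_eq[of j] ij by simp
  also have "A ^^ j \<circ> b l = A ^^ i \<circ> (A ^^ (j - i) \<circ> b l)"
    using ij by (simp flip: comp_assoc funpow_add)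
  also have "gp (A ^^ i \<circ> b l) (A ^^ i \<circ> (A ^^ (j - i) \<circ> b l)) \<le> gp (b l) (A ^^ (j - i) \<circ> b l) + len (A ^^ i)"
    by (rule gp_translate) (use A in auto)
  also have "gp (b l) (A ^^ (j - i) \<circ> b l) \<le> C + \<delta> + \<delta>"
  proof -
    have "gp (A ^^ (j - i) \<circ> b l) (b l) \<le> C + \<delta> + \<delta>"
    proof (rule gp_transfer)
      show "gp (A ^^ (j - i)) (b l) \<le> C + \<delta>" by (rule far_pow[OF A(4)])
      show "C + \<delta> + \<delta> < gp (A ^^ (j - i)) (A ^^ (j - i) \<circ> b l)"
        using pow_b[of "j - i" l] ij(1) \<delta> by linarith
    qed
    then show ?thesis by (simp add: gp_commute)
  qed
  finally show False using l iN[of i] ij C \<delta> by (simp add: algebra_simps)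
qed

text \<open>Passing to a subsequence \<open>r\<close> preserves \<open>fixed\<close>, because
  \<open>n \<le> r n\<close>.\<close>

lemma no_frequently_fixed_direction:
  assumes h: "\<And>n. h n \<in> \<Gamma>"
    and fixed: "\<And>n f. \<lbrakk>f \<in> \<Gamma>; len f \<le> real n\<rbrakk> \<Longrightarrow> real n - \<delta> \<le> gp (h n) (f \<circ> h n)"
    and ab: "\<And>k. a k \<in> \<Gamma>" "\<And>k. b k \<in> \<Gamma>"
    and unbounded: "\<And>M. \<exists>k. M \<le> len (a k)" "\<And>M. \<exists>k. M \<le> len (b k)"
    and far: "infinite {n. \<forall>k. gp (a k) (h n) \<le> C \<and> gp (b k) (h n) \<le> C}"
      "\<And>k l. gp (a k) (b l) \<le> C"
  shows False
proof -
  obtain r :: "nat \<Rightarrow> nat" where r: "strict_mono r"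
      "\<And>n. r n \<in> {n. \<forall>k. gp (a k) (h n) \<le> C \<and> gp (b k) (h n) \<le> C}"
    using infinite_enumerate[OF far(1)] by blast
  show False
  proof (rule no_fixed_direction[where h = "h \<circ> r" and a = a and b = b and C = C])
    fix n f assume f: "f \<in> \<Gamma>" "len f \<le> real n"
    have "n \<le> r n" by (rule seq_suble[OF r(1)])
    then have "real n \<le> real (r n)" by simp
    then show "real n - \<delta> \<le> gp ((h \<circ> r) n) (f \<circ> (h \<circ> r) n)"
      using fixed[of f "r n"] f by simp
  qed (use h ab unbounded far r in auto)
qed

text \<open>If no finite set works, testing the set of all elements of length at most
  \<open>n\<close> against the bound \<open>n\<close> yields \<open>g\<close> and \<open>h\<close>
  such that \<open>f \<circ> h\<close> points along \<open>g\<close> for all these \<open>f\<close>,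
  among them \<open>id\<close>. Hence all these \<open>f\<close> nearly fix the direction of
  \<open>h\<close>. Of three pairwise separated sequences at most one can point toward a given
  \<open>h n\<close>, so one pair stays away from infinitely many of the \<open>h n\<close>.\<close>

lemma extension:
  fixes a b c :: "nat \<Rightarrow> 'a \<Rightarrow> 'a"
  assumes mem: "\<And>k. a k \<in> \<Gamma>" "\<And>k. b k \<in> \<Gamma>" "\<And>k. c k \<in> \<Gamma>"
    and unbounded: "\<And>M. \<exists>k. M \<le> len (a k)" "\<And>M. \<exists>k. M \<le> len (b k)" "\<And>M. \<exists>k. M \<le> len (c k)"
    and sep: "\<And>k l. gp (a k) (b l) \<le> C" "\<And>k l. gp (b k) (c l) \<le> C" "\<And>k l. gp (a k) (c l) \<le> C"
  shows "\<exists>F B. finite F \<and> F \<subseteq> \<Gamma> \<and> (\<forall>g\<in>\<Gamma>. \<forall>h\<in>\<Gamma>. \<exists>f\<in>F. gp g (f \<circ> h) \<le> B)"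
proof (rule ccontr)
  assume "\<not> ?thesis"
  then have neg: "\<exists>g\<in>\<Gamma>. \<exists>h\<in>\<Gamma>. \<forall>f\<in>F. B < gp g (f \<circ> h)" if "finite F" "F \<subseteq> \<Gamma>" for F B
    using that by (meson not_le)
  have "\<exists>h\<in>\<Gamma>. \<forall>f\<in>\<Gamma>. len f \<le> real n \<longrightarrow> real n - \<delta> \<le> gp h (f \<circ> h)" for n :: nat
  proof -
    obtain g h where gh: "g \<in> \<Gamma>" "h \<in> \<Gamma>" "\<And>f. f \<in> \<Gamma> \<Longrightarrow> len f \<le> real n \<Longrightarrow> real n < gp g (f \<circ> h)"
      using neg[OF finite_len[of "real n"]] by blast
    have "real n - \<delta> \<le> gp h (f \<circ> h)" if "f \<in> \<Gamma>" "len f \<le> real n" for f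
      using gh(3)[OF that] gh(3)[OF id_mem] gp_hyperbolic[of h g "f \<circ> h"] gp_commute[of g h]
      by (simp add: len_def)
    then show ?thesis using gh(2) by blast
  qed
  then obtain h where h: "\<And>n. h n \<in> \<Gamma>"
    and fixed: "\<And>n f. \<lbrakk>f \<in> \<Gamma>; len f \<le> real n\<rbrakk> \<Longrightarrow> real n - \<delta> \<le> gp (h n) (f \<circ> h n)"
    by metis
  have two: "(\<forall>k. gp (p k) (h n) \<le> C + \<delta>) \<or> (\<forall>k. gp (q k) (h n) \<le> C + \<delta>)"
    if "\<And>k l. gp (p k) (q l) \<le> C" for p q :: "nat \<Rightarrow> 'a \<Rightarrow> 'a" and n
  proof (rule ccontr)
    assume "\<not> ?thesis"
    then obtain k l where "C + \<delta> < gp (p k) (h n)" "C + \<delta> < gp (h n) (q l)"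
      by (auto simp: not_le gp_commute)
    then show False using gp_hyperbolic[of "p k" "h n" "q l"] that[of k l] by simp
  qed
  define Far where "Far p q = {n. \<forall>k. gp (p k) (h n) \<le> C + \<delta> \<and> gp (q k) (h n) \<le> C + \<delta>}"
    for p q :: "nat \<Rightarrow> 'a \<Rightarrow> 'a"
  have "Far a b \<union> Far b c \<union> Far a c = UNIV"
    using two[of a b, OF sep(1)] two[of b c, OF sep(2)] two[of a c, OF sep(3)] unfolding Far_def by blast
  then have "infinite (Far a b) \<or> infinite (Far b c) \<or> infinite (Far a c)"
    by (metis finite_UnI infinite_UNIV_nat)
  moreover have "finite (Far p q)"
    if "\<And>k. p k \<in> \<Gamma>" "\<And>k. q k \<in> \<Gamma>" "\<And>M. \<exists>k. M \<le> len (p k)" "\<And>M. \<exists>k. M \<le> len (q k)"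
      "\<And>k l. gp (p k) (q l) \<le> C" for p q
  proof (rule ccontr)
    assume "infinite (Far p q)"
    moreover have "gp (p k) (q l) \<le> C + \<delta>" for k l
      using that(5)[of k l] delta_nonneg by simp
    ultimately show False
      using no_frequently_fixed_direction[of h p q "C + \<delta>"] h fixed that(1-4)
      unfolding Far_def by blast
  qed
  ultimately show False using mem unbounded sep by blast
qed

end

section \<open>Gromov sequences and limit points\<close>

lemma asymptotic_seqs_iff:
  "asymptotic_seqs u v \<longleftrightarrow> (\<forall>w M. \<exists>N. \<forall>m\<ge>N. \<forall>n\<ge>N. M \<le> gromov_product w (u m) (v n))"
  unfolding asymptotic_seqs_def filterlim_at_top eventually_prod_sequentially by fastforce

lemma asymptotic_seqs_sym: "asymptotic_seqs u v \<Longrightarrow> asymptotic_seqs v u"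
  unfolding asymptotic_seqs_iff by (metis gromov_product_commute)

context hyperbolic_space
begin

lemma asymptotic_seqs_trans:
  fixes u v w :: "nat \<Rightarrow> 'a"
  assumes "asymptotic_seqs u v" "asymptotic_seqs v w"
  shows "asymptotic_seqs u w"
  unfolding asymptotic_seqs_iff
proof (intro allI)
  fix y M
  obtain N1 where N1: "\<And>m n. m \<ge> N1 \<Longrightarrow> n \<ge> N1 \<Longrightarrow> M + \<delta> \<le> gromov_product y (u m) (v n)"
    using assms(1) unfolding asymptotic_seqs_iff by blast
  obtain N2 where N2: "\<And>m n. m \<ge> N2 \<Longrightarrow> n \<ge> N2 \<Longrightarrow> M + \<delta> \<le> gromov_product y (v m) (w n)"
    using assms(2) unfolding asymptotic_seqs_iff by blast
  have "M \<le> gromov_product y (u m) (w n)" if "m \<ge> max N1 N2" "n \<ge> max N1 N2" for m n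
    using N1[of m "max N1 N2"] N2[of "max N1 N2" n] hyperbolic[of y "u m" "v (max N1 N2)" "w n"] that
    by simp
  then show "\<exists>N. \<forall>m\<ge>N. \<forall>n\<ge>N. M \<le> gromov_product y (u m) (w n)" by blast
qed

lemma equiv_asymptotic_seqs:
  "equiv (gromov_sequences :: (nat \<Rightarrow> 'a) set)
     {(u, v). u \<in> gromov_sequences \<and> v \<in> gromov_sequences \<and> asymptotic_seqs u v}"
  by (rule equivI)
     (auto simp: refl_on_def sym_def trans_def gromov_sequences_def
       intro: asymptotic_seqs_sym asymptotic_seqs_trans)

text \<open>A single late pair with small product bounds all late pairs: since both are Gromov
  sequences, replacing \<open>u m0\<close> by \<open>u m\<close> and \<open>v n0\<close> by
  \<open>v n\<close> costs one \<open>\<delta>\<close> each.\<close>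

lemma not_asymptotic_bounded:
  fixes u v :: "nat \<Rightarrow> 'a"
  assumes "asymptotic_seqs u u" "asymptotic_seqs v v" "\<not> asymptotic_seqs u v"
  shows "\<exists>w C N. \<forall>m\<ge>N. \<forall>n\<ge>N. gromov_product w (u m) (v n) \<le> C"
proof -
  obtain w M where M: "\<And>N. \<exists>m\<ge>N. \<exists>n\<ge>N. gromov_product w (u m) (v n) < M"
    using assms(3) unfolding asymptotic_seqs_iff by (meson not_le)
  obtain N1 where N1: "\<And>m n. m \<ge> N1 \<Longrightarrow> n \<ge> N1 \<Longrightarrow> M + 2 * \<delta> \<le> gromov_product w (u m) (u n)"
    using assms(1) unfolding asymptotic_seqs_iff by blast
  obtain N2 where N2: "\<And>m n. m \<ge> N2 \<Longrightarrow> n \<ge> N2 \<Longrightarrow> M + 2 * \<delta> \<le> gromov_product w (v m) (v n)"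
    using assms(2) unfolding asymptotic_seqs_iff by blast
  obtain m0 n0 where *: "m0 \<ge> max N1 N2" "n0 \<ge> max N1 N2" "gromov_product w (u m0) (v n0) < M"
    using M by blast
  have "gromov_product w (u m) (v n) \<le> M + 2 * \<delta>" if "m \<ge> max N1 N2" "n \<ge> max N1 N2" for m n
    using N1[of m0 m] N2[of n n0] hyperbolic[of w "u m0" "u m" "v n0"] hyperbolic[of w "u m" "v n" "v n0"]
      * that delta_nonneg by simp
  then show ?thesis by blast
qed

end

context discrete_hyperbolic_group
begin

text \<open>The sequences represent three distinct limit points. The limit set comes with a base
  point \<open>y\<close> of its own and the separation with a base point \<open>w\<close>; moving
  both to \<open>x\<close> changes products by a bounded amount.\<close>

lemma non_elementary_separated:
  assumes "non_elementary \<Gamma>"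
  obtains a b c :: "nat \<Rightarrow> 'a \<Rightarrow> 'a" and C
  where "\<And>k. a k \<in> \<Gamma>" "\<And>k. b k \<in> \<Gamma>" "\<And>k. c k \<in> \<Gamma>"
    "\<And>M. \<exists>k. M \<le> len (a k)" "\<And>M. \<exists>k. M \<le> len (b k)" "\<And>M. \<exists>k. M \<le> len (c k)"
    "\<And>k l. gp (a k) (b l) \<le> C" "\<And>k l. gp (b k) (c l) \<le> C" "\<And>k l. gp (a k) (c l) \<le> C"
proof -
  obtain y where "infinite (limit_set \<Gamma> y) \<or> card (limit_set \<Gamma> y) > 2"
    using assms unfolding non_elementary_def by blast
  then have "\<exists>T \<subseteq> limit_set \<Gamma> y. card T = 3"
    by (metis infinite_arbitrarily_large obtain_subset_with_card_n Suc_leI numeral_3_eq_3 numeral_2_eq_2)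
  then obtain \<xi> \<eta> \<zeta> where distinct: "\<xi> \<noteq> \<eta>" "\<eta> \<noteq> \<zeta>" "\<xi> \<noteq> \<zeta>"
    and lim: "\<xi> \<in> limit_set \<Gamma> y" "\<eta> \<in> limit_set \<Gamma> y" "\<zeta> \<in> limit_set \<Gamma> y"
    by (auto simp: card_3_iff)
  have rep: "\<exists>a. (\<forall>k::nat. a k \<in> \<Gamma>) \<and> (\<lambda>k. a k y) \<in> \<xi>" if \<xi>: "\<xi> \<in> limit_set \<Gamma> y" for \<xi>
  proof -
    obtain u where "u \<in> \<xi>" "range u \<subseteq> orbit_of \<Gamma> y" using \<xi> unfolding limit_set_def by blast
    then have "\<forall>k. \<exists>g\<in>\<Gamma>. u k = g y" unfolding orbit_of_def by blast
    then obtain a where "\<forall>k. a k \<in> \<Gamma> \<and> u k = a k y" by metis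
    with \<open>u \<in> \<xi>\<close> show ?thesis by (metis ext)
  qed
  have bd: "\<xi> \<in> gromov_boundary" if "\<xi> \<in> limit_set \<Gamma> y" for \<xi>
    using that by (simp add: limit_set_def)
  have gromov: "asymptotic_seqs u u" if "u \<in> \<xi>" "\<xi> \<in> limit_set \<Gamma> y" for u \<xi>
    using that bd[OF that(2)] by (auto simp: gromov_boundary_def quotient_def gromov_sequences_def)
  have unb: "\<exists>N. \<forall>k\<ge>N. M \<le> len (a k)"
    if a: "\<And>k. a k \<in> \<Gamma>" "(\<lambda>k. a k y) \<in> \<xi>" "\<xi> \<in> limit_set \<Gamma> y" for a \<xi> M
  proof -
    obtain N where N: "\<And>m n. m \<ge> N \<Longrightarrow> n \<ge> N \<Longrightarrow> M + dist x y \<le> gromov_product x (a m y) (a n y)"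
      using gromov[OF a(2,3)] unfolding asymptotic_seqs_iff by blast
    have "M \<le> len (a k)" if "k \<ge> N" for k
      using N[OF that that] dist_triangle[of x "a k y" "a k x"] isom[OF a(1)[of k], of x y]
      by (simp add: gromov_product_self len_def)
    then show ?thesis by blast
  qed
  have sep: "\<exists>C N. \<forall>m\<ge>N. \<forall>n\<ge>N. gp (a m) (b n) \<le> C"
    if a: "\<And>k. a k \<in> \<Gamma>" "(\<lambda>k. a k y) \<in> \<xi>" "\<xi> \<in> limit_set \<Gamma> y"
      and b: "\<And>k. b k \<in> \<Gamma>" "(\<lambda>k. b k y) \<in> \<eta>" "\<eta> \<in> limit_set \<Gamma> y" and "\<xi> \<noteq> \<eta>" for a b \<xi> \<eta>
  proof -
    have "\<not> asymptotic_seqs (\<lambda>k. a k y) (\<lambda>k. b k y)"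
      using quotient_eq_iff[OF equiv_asymptotic_seqs, of \<xi> \<eta> "\<lambda>k. a k y" "\<lambda>k. b k y"] \<open>\<xi> \<noteq> \<eta>\<close>
        bd[OF a(3)] bd[OF b(3)] a b gromov[OF a(2,3)] gromov[OF b(2,3)]
      by (auto simp: gromov_boundary_def gromov_sequences_def)
    from not_asymptotic_bounded[OF gromov[OF a(2,3)] gromov[OF b(2,3)] this]
    obtain w C N where C: "\<And>m n. m \<ge> N \<Longrightarrow> n \<ge> N \<Longrightarrow> gromov_product w (a m y) (b n y) \<le> C"
      by blast
    have "gp (a m) (b n) \<le> C + dist x w + 2 * dist x y" if "m \<ge> N" "n \<ge> N" for m n
    proof -
      have "gp (a m) (b n) \<le> gromov_product x (a m y) (b n x) + dist x y"
        using gromov_product_Lipschitz[of x "a m x" "b n x" "a m y"] a(1) by (simp add: gp_def isom)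
      also have "gromov_product x (a m y) (b n x) \<le> gromov_product x (a m y) (b n y) + dist x y"
        using gromov_product_Lipschitz[of x "b n x" "a m y" "b n y"] b(1)
        by (simp add: isom gromov_product_commute)
      also have "gromov_product x (a m y) (b n y) \<le> gromov_product w (a m y) (b n y) + dist x w"
        by (rule gromov_product_Lipschitz_basepoint)
      finally show ?thesis using C[OF that] by simp
    qed
    then show ?thesis by blast
  qed
  obtain a b c where a: "\<And>k. a k \<in> \<Gamma>" "(\<lambda>k. a k y) \<in> \<xi>"
    and b: "\<And>k. b k \<in> \<Gamma>" "(\<lambda>k. b k y) \<in> \<eta>" and c: "\<And>k. c k \<in> \<Gamma>" "(\<lambda>k. c k y) \<in> \<zeta>"
    using rep lim by metis
  obtain C1 N1 where 1: "\<And>m n. m \<ge> N1 \<Longrightarrow> n \<ge> N1 \<Longrightarrow> gp (a m) (b n) \<le> C1"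
    using sep[OF a lim(1) b lim(2) distinct(1)] by blast
  obtain C2 N2 where 2: "\<And>m n. m \<ge> N2 \<Longrightarrow> n \<ge> N2 \<Longrightarrow> gp (b m) (c n) \<le> C2"
    using sep[OF b lim(2) c lim(3) distinct(2)] by blast
  obtain C3 N3 where 3: "\<And>m n. m \<ge> N3 \<Longrightarrow> n \<ge> N3 \<Longrightarrow> gp (a m) (c n) \<le> C3"
    using sep[OF a lim(1) c lim(3) distinct(3)] by blast
  \<comment> \<open>The separation bounds hold only for late terms, so the first \<open>N\<close>
    terms are dropped. The lengths are eventually large, hence the tails remain unbounded.\<close>
  define N where "N = max N1 (max N2 N3)"
  have unb': "\<exists>k. M \<le> len (p (k + N))" if "\<And>k. p k \<in> \<Gamma>" "(\<lambda>k. p k y) \<in> \<xi>" "\<xi> \<in> limit_set \<Gamma> y"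
    for p \<xi> M using unb[OF that, of M] by (meson le_add1)
  show thesis
  proof (rule that[of "\<lambda>k. a (k + N)" "\<lambda>k. b (k + N)" "\<lambda>k. c (k + N)" "max C1 (max C2 C3)"])
    show "\<And>k l. gp (a (k + N)) (b (l + N)) \<le> max C1 (max C2 C3)"
      using 1 by (simp add: N_def le_max_iff_disj)
    show "\<And>k l. gp (b (k + N)) (c (l + N)) \<le> max C1 (max C2 C3)"
      using 2 by (simp add: N_def le_max_iff_disj)
    show "\<And>k l. gp (a (k + N)) (c (l + N)) \<le> max C1 (max C2 C3)"
      using 3 by (simp add: N_def le_max_iff_disj)
  qed (use a b c lim unb' in auto)
qed

end

section \<open>Schottky sets\<close>

lemma pigeonhole_fiber:
  assumes "finite A" "A \<noteq> {}" "finite B" "f ` A \<subseteq> B"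
  shows "\<exists>b\<in>B. card A \<le> card B * card {a \<in> A. f a = b}"
proof -
  let ?c = "\<lambda>b. card {a \<in> A. f a = b}"
  have "B \<noteq> {}" using assms by blast
  then obtain b where b: "b \<in> B" "?c b = Max (?c ` B)"
    using Max_in[of "?c ` B"] assms(3) by fastforce
  have "A = (\<Union>b\<in>B. {a \<in> A. f a = b})" using assms(4) by auto
  then have "card A \<le> (\<Sum>b\<in>B. ?c b)"
    using card_UN_le[OF assms(3), of "\<lambda>b. {a \<in> A. f a = b}"] by simp
  also have "\<dots> \<le> card B * ?c b"
    using sum_bounded_above[of B ?c "?c b"] b assms(3) by simp
  finally show ?thesis using b(1) by blast
qed

text \<open>Every element of \<open>A\<close> is related to some member of a maximal set of pairwise
  unrelated elements, and each member accounts for at most \<open>N\<close> of them.\<close>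

lemma separated_subset:
  assumes "finite A" and nbrs: "\<And>a. a \<in> A \<Longrightarrow> card {b \<in> A. r a b} \<le> N"
    and refl: "\<And>a. a \<in> A \<Longrightarrow> r a a" and sym: "\<And>a b. r a b \<Longrightarrow> r b a"
  shows "\<exists>B\<subseteq>A. (\<forall>a\<in>B. \<forall>b\<in>B. a \<noteq> b \<longrightarrow> \<not> r a b) \<and> card A \<le> N * card B"
proof -
  let ?F = "{B. B \<subseteq> A \<and> (\<forall>a\<in>B. \<forall>b\<in>B. a \<noteq> b \<longrightarrow> \<not> r a b)}"
  have "finite ?F" by (rule finite_subset[of _ "Pow A"]) (use assms(1) in auto)
  moreover have "{} \<in> ?F" by simp
  ultimately obtain B where B: "B \<in> ?F" "\<And>B'. B' \<in> ?F \<Longrightarrow> B \<subseteq> B' \<Longrightarrow> B = B'"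
    using finite_has_maximal[of ?F] by (metis (no_types, lifting) empty_iff)
  have finB: "finite B" using B(1) assms(1) finite_subset by blast
  have "\<exists>b\<in>B. r b a" if "a \<in> A" for a
  proof (rule ccontr)
    assume no: "\<not> ?thesis"
    then have "insert a B \<in> ?F" using B(1) that sym by blast
    then have "a \<in> B" using B(2) by blast
    then show False using no refl that by blast
  qed
  then have "A = (\<Union>b\<in>B. {a \<in> A. r b a})" by blast
  then have "card A \<le> (\<Sum>b\<in>B. card {a \<in> A. r b a})"
    using card_UN_le[OF finB, of "\<lambda>b. {a \<in> A. r b a}"] by simp
  also have "\<dots> \<le> (\<Sum>b\<in>B. N)" using nbrs B(1) by (intro sum_mono) blast
  also have "\<dots> = N * card B" by simp
  finally show ?thesis using B(1) by (intro exI[of _ B]) simp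
qed

context discrete_hyperbolic_group
begin

lemma finite_orbit_ball: "finite (orbit_of \<Gamma> x \<inter> ball x T)"
proof (rule finite_subset)
  show "orbit_of \<Gamma> x \<inter> ball x T \<subseteq> (\<lambda>g. g x) ` {g \<in> \<Gamma>. dist x (g x) \<le> T}"
    by (auto simp: orbit_of_def)
qed (use finite_ball in blast)

text \<open>Points at the same distance from \<open>x\<close> on the geodesics to \<open>g x\<close> and \<open>h x\<close> lie in a compact
  ball, so finitely many colours detect when two directions are close.\<close>

lemma sectors:
  assumes "proper_space TYPE('a)" "geodesic_space TYPE('a)" and R: "0 \<le> R"
  shows "\<exists>\<kappa> (Z :: 'a set). finite Z \<and> (\<forall>g. R \<le> len g \<longrightarrow> \<kappa> g \<in> Z) \<and>
     (\<forall>g h. R \<le> len g \<longrightarrow> R \<le> len h \<longrightarrow> \<kappa> g = \<kappa> h \<longrightarrow> R - 1 - 2 * \<delta> \<le> gp g h)"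
proof -
  have "\<exists>y. dist x y = R \<and> dist y (g x) = len g - R" if "R \<le> len g" for g
  proof -
    obtain c where c: "c 0 = x" "c (dist x (g x)) = g x"
      "\<And>s t. s \<in> {0..dist x (g x)} \<Longrightarrow> t \<in> {0..dist x (g x)} \<Longrightarrow> dist (c s) (c t) = \<bar>s - t\<bar>"
      using assms(2) unfolding geodesic_space_def by meson
    show ?thesis
      using c(3)[of 0 R] c(3)[of R "dist x (g x)"] that R c(1,2)
      by (intro exI[of _ "c R"]) (auto simp: len_def)
  qed
  then obtain y where y: "\<And>g. R \<le> len g \<Longrightarrow> dist x (y g) = R"
      "\<And>g. R \<le> len g \<Longrightarrow> dist (y g) (g x) = len g - R" by metis
  have "compact (cball x R)" using assms(1) by (simp add: proper_space_def)
  moreover have "cball x R \<subseteq> (\<Union>z\<in>UNIV. ball z (1/2))"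
  proof
    fix z :: 'a
    have "z \<in> ball z (1/2)" by simp
    then show "z \<in> (\<Union>z\<in>UNIV. ball z (1/2))" by blast
  qed
  ultimately obtain Z where Z: "finite Z" "cball x R \<subseteq> (\<Union>z\<in>Z. ball z (1/2))"
    using compactE_image[of "cball x R" UNIV "\<lambda>z. ball z (1/2)"] by (metis open_ball)
  have "\<exists>z\<in>Z. dist z (y g) < 1/2" if "R \<le> len g" for g
    using Z(2) y(1)[OF that] by (force simp: subset_iff)
  then obtain \<kappa> where \<kappa>: "\<And>g. R \<le> len g \<Longrightarrow> \<kappa> g \<in> Z" "\<And>g. R \<le> len g \<Longrightarrow> dist (\<kappa> g) (y g) < 1/2"
    by metis
  have "R - 1 - 2 * \<delta> \<le> gp g h" if g: "R \<le> len g" "R \<le> len h" "\<kappa> g = \<kappa> h" for g h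
  proof -
    have yy: "dist (y g) (y h) < 1"
      using \<kappa>(2)[OF g(1)] \<kappa>(2)[OF g(2)] g(3) dist_triangle3[of "y g" "y h" "\<kappa> g"] by simp
    have a: "gromov_product x (y g) (g x) = R" "gromov_product x (y h) (h x) = R"
      using y[OF g(1)] y[OF g(2)] by (simp_all add: gromov_product_def len_def)
    have b: "R - 1 \<le> gromov_product x (y g) (y h)"
      using yy y(1)[OF g(1)] y(1)[OF g(2)] by (simp add: gromov_product_def)
    show ?thesis
      using hyperbolic[of x "y g" "y h" "h x"] hyperbolic[of x "g x" "y g" "h x"] a b
        gromov_product_commute[of x "g x" "y g"] delta_nonneg by (simp add: gp_def)
  qed
  then show ?thesis using Z(1) \<kappa>(1) by blast
qed

text \<open>For some large \<open>T\<close> the ball of radius \<open>T\<close> has more than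
  \<open>exp (h' * T)\<close> orbit points, with \<open>h' > h\<close>; the slack absorbs the
  division among at most \<open>T + 1\<close> annuli. The annulus found may have radius
  \<open>L\<close> much smaller than \<open>T\<close>, but it contains at least
  \<open>exp (h * (T + 1))\<close> points, which is more than enough.\<close>

lemma annulus_growth:
  assumes h: "0 < h" "ereal h < critical_exponent \<Gamma> x"
  shows "\<exists>L\<ge>L0. exp (h * L) \<le> card {y \<in> orbit_of \<Gamma> x. real L - 1 \<le> dist x y \<and> dist x y < real L}"
proof -
  obtain h' where h': "h < h'" "ereal h' < critical_exponent \<Gamma> x"
    using ereal_dense2[OF h(2)] by (metis ereal_less_eq(3) less_ereal.simps(1) not_le)
  let ?card = "\<lambda>T. card (orbit_of \<Gamma> x \<inter> ball x T)"
  \<comment> \<open>The last condition will force \<open>L0 \<le> L\<close>: an annulus with more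
    points than the ball of radius \<open>L0\<close> is not contained in that ball.\<close>
  have ev: "\<forall>\<^sub>F T in at_top. 0 < T \<and> (T + 1) * exp (h * (T + 1)) \<le> exp (h' * T)
      \<and> real (?card L0) < exp (h * (T + 1))"
  proof (intro eventually_conj)
    show "\<forall>\<^sub>F T in at_top. (T + 1) * exp (h * (T + 1)) \<le> exp (h' * T)"
      using h h' by real_asymp
    have "filterlim (\<lambda>T. exp (h * (T + 1))) at_top at_top" using h by real_asymp
    then show "\<forall>\<^sub>F T in at_top. real (?card L0) < exp (h * (T + 1))"
      by (simp add: filterlim_at_top_dense)
  qed (rule eventually_gt_at_top)
  have "\<not> (\<forall>\<^sub>F T in at_top. ereal (ln (real (?card T)) / T) \<le> ereal h')"
    using h'(2) Limsup_bounded[of "\<lambda>T. ereal (ln (real (?card T)) / T)" "ereal h'" at_top]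
    unfolding critical_exponent_def by (auto simp: not_le)
  then have "\<exists>\<^sub>F T in at_top. h' < ln (real (?card T)) / T"
    by (simp add: frequently_def not_less)
  then obtain T where T: "0 < T" "(T + 1) * exp (h * (T + 1)) \<le> exp (h' * T)"
      "real (?card L0) < exp (h * (T + 1))" "h' < ln (real (?card T)) / T"
    using frequently_ex[OF frequently_eventually_conj[OF _ ev]] by blast
  have hT: "h' * T < ln (real (?card T))" using T(1,4) by (simp add: field_simps)
  moreover have "0 < h' * T" using h h' T by simp
  ultimately have pos: "0 < ?card T" by (auto intro!: Nat.gr0I)
  have big: "exp (h' * T) < ?card T"
    using hT pos by (metis exp_less_mono exp_ln of_nat_0_less_iff)
  define f where "f y = Suc (nat \<lfloor>dist x y\<rfloor>)" for y
  have sub: "f ` (orbit_of \<Gamma> x \<inter> ball x T) \<subseteq> {1..Suc (nat \<lfloor>T\<rfloor>)}"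
    by (auto simp: f_def intro!: nat_mono floor_mono)
  have "orbit_of \<Gamma> x \<inter> ball x T \<noteq> {}" using pos by (metis card.empty less_irrefl)
  from pigeonhole_fiber[OF finite_orbit_ball this _ sub] obtain L where L: "L \<in> {1..Suc (nat \<lfloor>T\<rfloor>)}"
      "?card T \<le> Suc (nat \<lfloor>T\<rfloor>) * card {y \<in> orbit_of \<Gamma> x \<inter> ball x T. f y = L}"
    by (metis card_atLeastAtMost diff_Suc_1 finite_atLeastAtMost)
  let ?A = "{y \<in> orbit_of \<Gamma> x. real L - 1 \<le> dist x y \<and> dist x y < real L}"
  have finA: "finite ?A"
    by (rule finite_subset[OF _ finite_orbit_ball[of "real L"]]) auto
  have LT: "real L \<le> T + 1" using L(1) T(1) by (auto simp: le_nat_iff le_floor_iff) linarith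
  have "{y \<in> orbit_of \<Gamma> x \<inter> ball x T. f y = L} \<subseteq> ?A"
    by (auto simp: f_def) linarith+
  then have "card {y \<in> orbit_of \<Gamma> x \<inter> ball x T. f y = L} \<le> card ?A" by (rule card_mono[OF finA])
  then have le: "?card T \<le> Suc (nat \<lfloor>T\<rfloor>) * card ?A" using L(2) by (meson mult_le_mono2 order_trans)
  have "real (?card T) \<le> Suc (nat \<lfloor>T\<rfloor>) * real (card ?A)"
    using of_nat_mono[OF le, where 'a = real] by (simp only: of_nat_mult)
  also have "\<dots> \<le> (T + 1) * real (card ?A)" using T(1) by (intro mult_right_mono) auto
  finally have "(T + 1) * exp (h * (T + 1)) \<le> (T + 1) * card ?A" using big T(2) by linarith
  then have A: "exp (h * (T + 1)) \<le> card ?A" using T(1) by simp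
  have "L0 \<le> L"
  proof (rule ccontr)
    assume "\<not> L0 \<le> L"
    then have "?A \<subseteq> orbit_of \<Gamma> x \<inter> ball x L0" by auto
    then have "card ?A \<le> ?card L0" by (rule card_mono[OF finite_orbit_ball])
    then show False using A T(3) by linarith
  qed
  have "exp (h * L) \<le> exp (h * (T + 1))" using LT h(1) by simp
  then have "exp (h * L) \<le> card ?A" using A by linarith
  with \<open>L0 \<le> L\<close> show ?thesis by blast
qed

text \<open>One correcting element \<open>f\<close> serves for all of \<open>S\<close>. It is chosen
  for a single \<open>g0\<close>, and every element of the colour class points in the direction of
  \<open>g0\<close>, as do the inverses in that of \<open>ginv g0\<close>. Up to twice the length of
  \<open>f\<close>, the corner in \<open>(g \<circ> f) \<circ> (k \<circ> f)\<close> is the one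
  between \<open>ginv g\<close> and \<open>f \<circ> k\<close>. The constant depends only on
  \<open>\<delta>\<close>, \<open>F\<close> and \<open>B\<close>, so \<open>D\<close> and
  \<open>L0\<close> can be prescribed after it.\<close>

lemma schottky:
  assumes geom: "proper_space TYPE('a)" "geodesic_space TYPE('a)"
    and "non_elementary \<Gamma>" and h: "0 < h" "ereal h < critical_exponent \<Gamma> x"
  shows "\<exists>C\<ge>0. \<forall>D L0. \<exists>L\<ge>L0. \<exists>S. finite S \<and> S \<subseteq> \<Gamma> \<and>
      (\<forall>s\<in>S. L - C \<le> len s \<and> len s \<le> L) \<and>
      (\<forall>s\<in>S. \<forall>s'\<in>S. gp (ginv s) s' \<le> C) \<and>
      (\<forall>s\<in>S. \<forall>s'\<in>S. s \<noteq> s' \<longrightarrow> D \<le> dist (s x) (s' x)) \<and>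
      exp (h * L) \<le> card S"
proof -
  obtain h' where h': "h < h'" "ereal h' < critical_exponent \<Gamma> x"
    using ereal_dense2[OF h(2)] by (metis ereal_less_eq(3) less_ereal.simps(1) not_le)
  have "\<exists>F B. finite F \<and> F \<subseteq> \<Gamma> \<and> (\<forall>g\<in>\<Gamma>. \<forall>h\<in>\<Gamma>. \<exists>f\<in>F. gp g (f \<circ> h) \<le> B)"
    by (rule non_elementary_separated[OF assms(3)]) (rule extension)
  then obtain F B where F: "finite F" "F \<subseteq> \<Gamma>"
      "\<And>g h. g \<in> \<Gamma> \<Longrightarrow> h \<in> \<Gamma> \<Longrightarrow> \<exists>f\<in>F. gp g (f \<circ> h) \<le> B"
    by blast
  have B: "0 \<le> B" using F(3)[OF id_mem id_mem] gp_nonneg order_trans by blast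
  define M where "M = (\<Sum>f\<in>F. len f)"
  have M: "len f \<le> M" if "f \<in> F" for f
    unfolding M_def using that F(1) by (intro member_le_sum) (auto simp: len_nonneg)
  have M0: "0 \<le> M" unfolding M_def by (intro sum_nonneg len_nonneg)
  \<comment> \<open>\<open>B + 2 * \<delta>\<close> bounds the corner between \<open>ginv g\<close>
    and \<open>f \<circ> k\<close>, and \<open>2 * M\<close> pays for the two occurrences of
    \<open>f\<close>. The \<open>1\<close> is the thickness of the annulus, needed in the lower
    bound for lengths.\<close>
  define C where "C = B + 2 * \<delta> + 2 * M + 1"
  \<comment> \<open>Equal colours give products of at least \<open>R - 1 - 2 * \<delta>\<close>.
    These have to exceed \<open>B + 2 * \<delta>\<close> even after a translation by
    \<open>f\<close>, which costs up to \<open>M\<close>.\<close>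
  define R where "R = M + B + 4 * \<delta> + 3"
  have R: "0 \<le> R" using M0 B delta_nonneg by (simp add: R_def)
  from sectors[OF geom R] obtain \<kappa> and Z :: "'a set" where Z: "finite Z"
    and \<kappa>: "\<And>g. R \<le> len g \<Longrightarrow> \<kappa> g \<in> Z"
      "\<And>g h. R \<le> len g \<Longrightarrow> R \<le> len h \<Longrightarrow> \<kappa> g = \<kappa> h \<Longrightarrow> R - 1 - 2 * \<delta> \<le> gp g h"
    by blast
  have "\<exists>L\<ge>L0. \<exists>S. finite S \<and> S \<subseteq> \<Gamma> \<and>
      (\<forall>s\<in>S. L - C \<le> len s \<and> len s \<le> L) \<and>
      (\<forall>s\<in>S. \<forall>s'\<in>S. gp (ginv s) s' \<le> C) \<and>
      (\<forall>s\<in>S. \<forall>s'\<in>S. s \<noteq> s' \<longrightarrow> D \<le> dist (s x) (s' x)) \<and>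
      exp (h * L) \<le> card S" for D L0
  proof -
    \<comment> \<open>With \<open>max D 1\<close> in place of \<open>D\<close> the relation of being
      close is reflexive even if \<open>D \<le> 0\<close>.\<close>
    define N where "N = card {u \<in> \<Gamma>. len u \<le> max D 1}"
    define K where "K = real (card (Z \<times> Z) * N)"
    \<comment> \<open>The gap between \<open>h\<close> and \<open>h'\<close> pays for the factor
      \<open>K\<close> lost to colours and thinning, and for the final length bound being
      \<open>L + M\<close>, since \<open>f\<close> adds up to \<open>M\<close>. Positivity of
      \<open>K\<close> is not yet known here, hence \<open>max K 1\<close>.\<close>
    define L1 where "L1 = (ln (max K 1) + h * M) / (h' - h)"
    have L1: "K * exp (h * (L + M)) \<le> exp (h' * L)" if "L1 \<le> L" for L
    proof -
      have "ln (max K 1) + h * (L + M) \<le> h' * L"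
        using that h'(1) by (simp add: L1_def field_simps)
      then have "exp (ln (max K 1) + h * (L + M)) \<le> exp (h' * L)" by simp
      moreover have "K * exp (h * (L + M)) \<le> exp (ln (max K 1) + h * (L + M))"
        by (simp add: exp_add)
      ultimately show ?thesis by linarith
    qed
    obtain n0 :: nat where n0: "max L0 (max L1 (R + 1)) \<le> n0" using real_arch_simple by blast
    have "0 < h'" using h h' by simp
    from annulus_growth[OF this h'(2), of n0] obtain L :: nat where L: "n0 \<le> L"
      "exp (h' * L) \<le> card {y \<in> orbit_of \<Gamma> x. real L - 1 \<le> dist x y \<and> dist x y < real L}"
      by blast
    define A0 where "A0 = {y \<in> orbit_of \<Gamma> x. real L - 1 \<le> dist x y \<and> dist x y < real L}"
    have Lbig: "L0 \<le> L" "L1 \<le> L" "R + 1 \<le> L" using n0 L(1) by linarith+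
    have "\<forall>y\<in>A0. \<exists>g\<in>\<Gamma>. y = g x" by (auto simp: A0_def orbit_of_def)
    then obtain G where G: "\<And>y. y \<in> A0 \<Longrightarrow> G y \<in> \<Gamma> \<and> G y x = y" by metis
    define A where "A = G ` A0"
    have injG: "inj_on G A0" by (rule inj_onI) (metis G)
    have cardA: "exp (h' * L) \<le> card A" using L(2) unfolding A_def card_image[OF injG] unfolding A0_def .
    have A: "g \<in> \<Gamma>" "real L - 1 \<le> len g" "len g < L" if "g \<in> A" for g
      using that G by (auto simp: A_def len_def A0_def)
    have "0 < card A" using cardA by (metis exp_gt_zero gr_zeroI leD of_nat_0)
    then have finA: "finite A" "A \<noteq> {}" by (auto simp: card_gt_0_iff)
    have AR: "R \<le> len g" if "g \<in> A" for g using A(2)[OF that] Lbig by simp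
    have "(\<lambda>g. (\<kappa> (ginv g), \<kappa> g)) ` A \<subseteq> Z \<times> Z" using \<kappa>(1) A(1) AR by auto
    from pigeonhole_fiber[OF finA _ this] obtain z where
      z: "card A \<le> card (Z \<times> Z) * card {g \<in> A. (\<kappa> (ginv g), \<kappa> g) = z}" using Z by blast
    define A1 where "A1 = {g \<in> A. (\<kappa> (ginv g), \<kappa> g) = z}"
    have A1A: "A1 \<subseteq> A" by (auto simp: A1_def)
    have "A1 \<noteq> {}" using z \<open>0 < card A\<close> unfolding A1_def[symmetric] by auto
    then obtain g0 where g0: "g0 \<in> A1" by blast
    have mem: "g \<in> \<Gamma>" if "g \<in> A1" for g using that A(1) A1A by blast
    obtain f where f: "f \<in> F" "gp (ginv g0) (f \<circ> g0) \<le> B" using F(3) mem[OF g0] by blast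
    have f\<Gamma>: "f \<in> \<Gamma>" using f F by blast
    have close: "R - 1 - 2 * \<delta> \<le> gp g k" "R - 1 - 2 * \<delta> \<le> gp (ginv g) (ginv k)"
      if "g \<in> A1" "k \<in> A1" for g k
      using that AR A1A mem by (auto simp: A1_def intro!: \<kappa>(2))
    have angle: "gp (ginv (g \<circ> f)) (k \<circ> f) \<le> C" if gk: "g \<in> A1" "k \<in> A1" for g k
    proof -
      have 1: "B + 2 * \<delta> < gp (ginv g0) (ginv g)" using close(2)[OF g0 gk(1)] M0 by (simp add: R_def)
      have 2: "B + 2 * \<delta> < gp (f \<circ> g0) (f \<circ> k)"
        using close(1)[OF g0 gk(2)] gp_translate(1)[OF f\<Gamma>, of g0 k] M[OF f(1)] by (simp add: R_def)
      have 3: "gp (ginv g) (f \<circ> g0) \<le> B + \<delta>"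
        by (rule gp_transfer[OF f(2)]) (use 1 delta_nonneg in simp)
      have "gp (f \<circ> k) (ginv g) \<le> B + \<delta> + \<delta>"
        by (rule gp_transfer[of "f \<circ> g0"]) (use 2 3 delta_nonneg in \<open>simp_all add: gp_commute\<close>)
      then have "gp (ginv g) (f \<circ> k) \<le> B + 2 * \<delta>" by (simp add: gp_commute)
      moreover have "gp (ginv (g \<circ> f)) (k \<circ> f) \<le> gp (ginv g) (f \<circ> (k \<circ> f)) + len f"
        using gp_comp_left[of "ginv f" "ginv g" "k \<circ> f"] f\<Gamma> mem gk by (simp add: inv_comp)
      moreover have "gp (ginv g) (f \<circ> (k \<circ> f)) \<le> gp (ginv g) (f \<circ> k) + len f"
        using gp_comp_right[of "f \<circ> k" "ginv g" f] f\<Gamma> mem gk by (simp add: comp_assoc)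
      ultimately show ?thesis using M[OF f(1)] by (simp add: C_def)
    qed
    define S1 where "S1 = (\<lambda>g. g \<circ> f) ` A1"
    have "inj_on (\<lambda>g. g \<circ> f) A1"
      by (rule inj_onI) (metis comp_assoc comp_id surj_iff surj f\<Gamma>)
    then have cardS1: "card S1 = card A1" by (simp add: S1_def card_image)
    have finS1: "finite S1" unfolding S1_def using finA A1A finite_subset by blast
    have S1\<Gamma>: "S1 \<subseteq> \<Gamma>" using mem f\<Gamma> by (auto simp: S1_def)
    let ?r = "\<lambda>s s'. dist (s x) (s' x) < max D 1"
    have nbrs: "card {b \<in> S1. ?r a b} \<le> N" if a: "a \<in> S1" for a
      unfolding N_def
    proof (rule card_inj_on_le[where f = "\<lambda>b. ginv a \<circ> b"])
      have "a \<in> \<Gamma>" using a S1\<Gamma> by blast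
      then show "inj_on ((\<circ>) (ginv a)) {b \<in> S1. ?r a b}"
        by (intro inj_onI) (metis apply_inv comp_apply ext)
      show "(\<circ>) (ginv a) ` {b \<in> S1. ?r a b} \<subseteq> {u \<in> \<Gamma>. len u \<le> max D 1}"
        using \<open>a \<in> \<Gamma>\<close> S1\<Gamma> dist_orbit[of a] by (force simp del: max.bounded_iff)
    qed (rule finite_len)
    have "\<exists>S\<subseteq>S1. (\<forall>s\<in>S. \<forall>s'\<in>S. s \<noteq> s' \<longrightarrow> \<not> ?r s s') \<and> card S1 \<le> N * card S"
      by (rule separated_subset[OF finS1 nbrs]) (simp_all add: dist_commute less_max_iff_disj)
    then obtain S where S: "S \<subseteq> S1" "\<And>s s'. s \<in> S \<Longrightarrow> s' \<in> S \<Longrightarrow> s \<noteq> s' \<Longrightarrow> \<not> ?r s s'"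
        "card S1 \<le> N * card S"
      by blast
    have "card A \<le> card (Z \<times> Z) * (N * card S)"
      using z S(3) cardS1 unfolding A1_def[symmetric] by (metis mult_le_mono2 order_trans)
    then have "real (card A) \<le> K * card S" by (simp add: K_def flip: of_nat_mult mult.assoc)
    then have "K * exp (h * (L + M)) \<le> K * card S" using cardA L1[OF Lbig(2)] by linarith
    moreover have "0 < K"
    proof -
      have "0 < K * card S" using \<open>real (card A) \<le> K * card S\<close> \<open>0 < card A\<close> by linarith
      then show ?thesis by (simp add: zero_less_mult_iff K_def)
    qed
    ultimately have "exp (h * (L + M)) \<le> card S" by simp
    moreover have "L + M - C \<le> len s \<and> len s \<le> L + M" if s: "s \<in> S" for s
    proof -
      obtain g where g: "g \<in> A1" "s = g \<circ> f" using s S(1) by (auto simp: S1_def)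
      then show ?thesis
        using len_comp_le[OF mem, of g f] len_comp_ge[OF mem, of g f] A(2,3)[of g] A1A M[OF f(1)] B M0 delta_nonneg
        by (auto simp: C_def)
    qed
    moreover have "D \<le> dist (s x) (s' x)" if "s \<in> S" "s' \<in> S" "s \<noteq> s'" for s s'
      using S(2)[OF that] by simp
    moreover have "gp (ginv s) s' \<le> C" if ss': "s \<in> S" "s' \<in> S" for s s'
    proof -
      obtain g k where "g \<in> A1" "k \<in> A1" "s = g \<circ> f" "s' = k \<circ> f"
        using ss' S(1) unfolding S1_def by blast
      then show ?thesis using angle by simp
    qed
    moreover have "L0 \<le> L + M" using Lbig M0 by simp
    moreover have "finite S" "S \<subseteq> \<Gamma>" using S(1) finS1 S1\<Gamma> finite_subset by blast+
    ultimately show ?thesis by (intro exI[of _ "L + M"] conjI exI[of _ S]) auto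
  qed
  moreover have "0 \<le> C" using B M0 delta_nonneg by (simp add: C_def)
  ultimately show ?thesis by blast
qed

end

section \<open>Geodesic lines along words\<close>

lemma closed_dist_at: "closed {f :: 'b \<Rightarrow> 'a::metric_space. dist (f s) (f t) = c}"
  by (intro closed_Collect_eq continuous_intros) auto

lemma closed_dist_point_at: "closed {f :: 'b \<Rightarrow> 'a::metric_space. dist (f t) y \<le> c}"
  by (intro closed_Collect_le continuous_intros) auto

text \<open>The function type carries the topology of pointwise convergence, so this is the
  Tychonoff theorem.\<close>

lemma compact_Pi_cball:
  assumes "proper_space TYPE('a::metric_space)"
  shows "compact {f :: 'b \<Rightarrow> 'a. \<forall>t. f t \<in> cball y (r t)}"
proof -
  have "compactin (product_topology (\<lambda>i. euclidean) UNIV) (PiE UNIV (\<lambda>t::'b. cball y (r t)))"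
    unfolding compactin_PiE using assms by (simp add: proper_space_def)
  then have "compact (PiE UNIV (\<lambda>t::'b. cball y (r t)))"
    by (simp add: euclidean_product_topology)
  moreover have "PiE UNIV (\<lambda>t::'b. cball y (r t)) = {f. \<forall>t. f t \<in> cball y (r t)}"
    by (auto simp: PiE_UNIV_domain)
  ultimately show ?thesis by simp
qed

context discrete_hyperbolic_group
begin

primrec word :: "(nat \<Rightarrow> 'a \<Rightarrow> 'a) \<Rightarrow> nat \<Rightarrow> 'a \<Rightarrow> 'a" where
  "word \<sigma> 0 = id"
| "word \<sigma> (Suc k) = word \<sigma> k \<circ> \<sigma> k"

lemma word_mem: "range \<sigma> \<subseteq> \<Gamma> \<Longrightarrow> word \<sigma> k \<in> \<Gamma>"
  by (induction k) auto

lemma word_cong: "(\<And>i. i < k \<Longrightarrow> \<sigma> i = \<sigma>' i) \<Longrightarrow> word \<sigma> k = word \<sigma>' k"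
  by (induction k) auto

lemma word_add: "word \<sigma> (m + k) = word \<sigma> m \<circ> word (\<lambda>i. \<sigma> (m + i)) k"
  by (induction k) (auto simp: comp_assoc)

lemma word_const: "word (\<lambda>_. s) k = s ^^ k"
  by (induction k) (auto simp: funpow_swap1 fun_eq_iff)

context
  fixes S :: "('a \<Rightarrow> 'a) set" and C L :: real
  assumes S: "S \<subseteq> \<Gamma>"
    and angle: "\<And>s s'. \<lbrakk>s \<in> S; s' \<in> S\<rbrakk> \<Longrightarrow> gp (ginv s) s' \<le> C"
    and long: "\<And>s. s \<in> S \<Longrightarrow> 2 * C + 4 * \<delta> + 1 \<le> len s"
    and short: "\<And>s. s \<in> S \<Longrightarrow> len s \<le> L"
    and proper: "proper_space TYPE('a)" and geodesic: "geodesic_space TYPE('a)"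
begin

lemma word_mem_S: "range \<sigma> \<subseteq> S \<Longrightarrow> word \<sigma> k \<in> \<Gamma>"
  using S by (intro word_mem) blast

lemma dist_word_Suc: "range \<sigma> \<subseteq> S \<Longrightarrow> dist (word \<sigma> k x) (word \<sigma> (Suc k) x) = len (\<sigma> k)"
  using isom[OF word_mem_S[of \<sigma> k], of x "\<sigma> k x"] by (simp add: len_def)

lemma word_angle:
  assumes \<sigma>: "range \<sigma> \<subseteq> S" and "i \<le> k" "k \<le> n"
  shows "gromov_product (word \<sigma> k x) (word \<sigma> i x) (word \<sigma> n x) \<le> C + 2 * \<delta>"
proof (rule chain_angle[OF _ _ assms(2,3)])
  fix i
  have \<Gamma>: "word \<sigma> (Suc i) \<in> \<Gamma>" "\<sigma> i \<in> \<Gamma>"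
    using word_mem_S[OF \<sigma>] range_subsetD[OF \<sigma>] S by blast+
  have "gromov_product (word \<sigma> (Suc i) x) (word \<sigma> i x) (word \<sigma> (Suc (Suc i)) x)
      = gp (ginv (\<sigma> i)) (\<sigma> (Suc i))"
    using gromov_product_isom[OF \<Gamma>(1), of x "ginv (\<sigma> i) x" "\<sigma> (Suc i) x"] \<Gamma>(2)
    by (simp add: gp_def)
  then show "gromov_product (word \<sigma> (Suc i) x) (word \<sigma> i x) (word \<sigma> (Suc (Suc i)) x) \<le> C"
    using angle range_subsetD[OF \<sigma>] by simp
  show "2 * C + 3 * \<delta> + 1 \<le> dist (word \<sigma> i x) (word \<sigma> (Suc i) x)"
    using long[OF range_subsetD[OF \<sigma>, of i]] dist_word_Suc[OF \<sigma>, of i] delta_nonneg by simp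
qed

lemma word_dist:
  assumes \<sigma>: "range \<sigma> \<subseteq> S" and "i \<le> k" "k \<le> n"
  shows "dist (word \<sigma> i x) (word \<sigma> k x) + dist (word \<sigma> k x) (word \<sigma> n x) - 2 * (C + 2 * \<delta>)
    \<le> dist (word \<sigma> i x) (word \<sigma> n x)"
  using word_angle[OF assms] by (simp add: gromov_product_def dist_commute)

text \<open>A further letter adds its length minus at most twice the corner bound
  \<open>C + 2 * \<delta>\<close>; the constant in \<open>long\<close> leaves a gain of at least
  1.\<close>

lemma word_dist_ge:
  assumes \<sigma>: "range \<sigma> \<subseteq> S"
  shows "real k \<le> dist (word \<sigma> i x) (word \<sigma> (i + k) x)"
proof (induction k)
  case (Suc k)
  then show ?case
    using word_dist[OF \<sigma>, of i "i + k" "Suc (i + k)"] dist_word_Suc[OF \<sigma>, of "i + k"]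
      long[OF range_subsetD[OF \<sigma>, of "i + k"]] by (simp del: word.simps)
qed simp

lemma len_word_le:
  assumes \<sigma>: "range \<sigma> \<subseteq> S"
  shows "len (word \<sigma> k) \<le> k * L"
proof (induction k)
  case (Suc k)
  have "real (Suc k) * L = k * L + L" by (simp add: algebra_simps)
  then show ?case
    using Suc len_comp_le[OF word_mem_S[OF \<sigma>], of k "\<sigma> k"] short[OF range_subsetD[OF \<sigma>, of k]]
    unfolding word.simps by linarith
qed (simp add: len_def)

text \<open>A word prescribes only a forward direction. It is therefore preceded by \<open>N\<close>
  copies of its initial letter and moved back by \<open>ginv (s0 ^^ N)\<close>, so that a geodesic
  from \<open>a\<close> to \<open>b\<close> passes near \<open>x\<close> with length at least
  \<open>N - 2 * E\<close> on either side. Time 0 is put at distance \<open>dist a x\<close> from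
  \<open>a\<close>, and the segment is extended by constants to a 1-Lipschitz map on the whole real
  line.\<close>

lemma segment_along_word:
  assumes \<sigma>: "range \<sigma> \<subseteq> S"
  defines "E \<equiv> C + 2 * \<delta>"
  shows "\<exists>f. (\<forall>s t. dist (f s) (f t) \<le> \<bar>s - t\<bar>) \<and>
     (\<forall>s t. \<bar>s\<bar> \<le> real N - 2 * E \<longrightarrow> \<bar>t\<bar> \<le> real N - 2 * E \<longrightarrow> dist (f s) (f t) = \<bar>s - t\<bar>) \<and>
     (\<forall>k\<le>N. len (word \<sigma> k) \<le> real N - 2 * E \<longrightarrow>
        dist (f (len (word \<sigma> k))) (word \<sigma> k x) \<le> 4 * E + 2 * \<delta>)"
proof -
  define s0 where "s0 = \<sigma> 0"
  have "s0 \<in> S" using range_subsetD[OF \<sigma>] by (simp add: s0_def)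
  then have s0: "s0 \<in> \<Gamma>" using S by blast
  have C: "0 \<le> C" using angle[of s0 s0] \<open>s0 \<in> S\<close> gp_nonneg order_trans by blast
  have E: "0 \<le> E" using C delta_nonneg by (simp add: E_def)
  define \<tau> where "\<tau> i = (if i < N then s0 else \<sigma> (i - N))" for i
  have \<tau>: "range \<tau> \<subseteq> S" using range_subsetD[OF \<sigma>] by (auto simp: \<tau>_def s0_def)
  have wN: "word \<tau> N = s0 ^^ N"
    using word_cong[of N \<tau> "\<lambda>_. s0"] by (simp add: \<tau>_def word_const)
  have wk: "word \<tau> (N + k) = s0 ^^ N \<circ> word \<sigma> k" for k
    using word_add[of \<tau> N k] by (simp add: wN \<tau>_def)
  define g where "g = ginv (s0 ^^ N)"
  have g: "g \<in> \<Gamma>" using s0 by (simp add: g_def)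
  have gk: "g (word \<tau> (N + k) x) = word \<sigma> k x" for k
    using s0 by (simp add: wk g_def)
  define a where "a = g x"
  define b where "b = word \<sigma> N x"
  have ang: "gromov_product (word \<sigma> k x) a (word \<sigma> n x) \<le> E" if "k \<le> n" for k n
    using word_angle[OF \<tau>, of 0 "N + k" "N + n"] gromov_product_isom[OF g, of "word \<tau> (N + k) x" x "word \<tau> (N + n) x"]
      that gk by (simp add: a_def E_def)
  define \<alpha> where "\<alpha> = dist a x"
  define l where "l = dist a b"
  have \<alpha>: "real N \<le> \<alpha>"
    using word_dist_ge[OF \<tau>, of N 0] isom[OF g, of x "word \<tau> N x"] gk[of 0]
    by (simp add: \<alpha>_def a_def)
  have l: "\<alpha> + dist x b - 2 * E \<le> l"
    using ang[of 0 N] by (simp add: gromov_product_def \<alpha>_def l_def b_def dist_commute)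
  have xb: "real N \<le> dist x b" using word_dist_ge[OF \<sigma>, of N 0] by (simp add: b_def)
  obtain c where c: "c 0 = a" "c l = b" "\<And>s t. s \<in> {0..l} \<Longrightarrow> t \<in> {0..l} \<Longrightarrow> dist (c s) (c t) = \<bar>s - t\<bar>"
    using geodesic unfolding geodesic_space_def l_def by meson
  have l0: "0 \<le> l" by (simp add: l_def)
  define f where "f t = c (max 0 (min l (t + \<alpha>)))" for t
  have lip: "dist (f s) (f t) \<le> \<bar>s - t\<bar>" for s t
    using l0 by (simp add: f_def c(3))
  have in_range: "t + \<alpha> \<in> {0..l}" if "\<bar>t\<bar> \<le> real N - 2 * E" for t
    using that \<alpha> l xb E by (auto simp: abs_le_iff)
  have inside: "f t = c (t + \<alpha>)" "t + \<alpha> \<in> {0..l}" if "\<bar>t\<bar> \<le> real N - 2 * E" for t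
    using in_range[OF that] by (simp_all add: f_def)
  have iso: "dist (f s) (f t) = \<bar>s - t\<bar>" if "\<bar>s\<bar> \<le> real N - 2 * E" "\<bar>t\<bar> \<le> real N - 2 * E" for s t
    using inside[OF that(1)] inside[OF that(2)] c(3) by simp
  have near: "dist (f (len (word \<sigma> k))) (word \<sigma> k x) \<le> 4 * E + 2 * \<delta>"
    if k: "k \<le> N" "len (word \<sigma> k) \<le> real N - 2 * E" for k
  proof -
    let ?p = "word \<sigma> k x" and ?u = "len (word \<sigma> k) + \<alpha>"
    have "\<bar>len (word \<sigma> k)\<bar> \<le> real N - 2 * E" using k by (simp add: len_nonneg)
    note in' = inside[OF this]
    have "dist (c ?u) ?p \<le> \<bar>?u - dist a ?p\<bar> + 2 * gromov_product ?p a b + 2 * \<delta>"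
      by (rule dist_geodesic_point_le) (use in' c(1,2) c(3)[of 0 ?u] c(3)[of ?u l] l0 in \<open>auto simp: l_def[symmetric]\<close>)
    moreover have "gromov_product ?p a b \<le> E" using ang[OF k(1)] by (simp add: b_def)
    \<comment> \<open>The vertex is reached at time \<open>len (word \<sigma> k)\<close>, measured
      from \<open>x\<close>, whereas the geodesic is measured from \<open>a\<close>. The discrepancy
      is twice the product at \<open>x\<close>.\<close>
    moreover have "\<bar>?u - dist a ?p\<bar> \<le> 2 * E"
      using ang[of 0 k] gromov_product_nonneg[of x a ?p]
      by (simp add: gromov_product_def \<alpha>_def len_def dist_commute)
    ultimately show ?thesis using in'(1) by simp
  qed
  show ?thesis using lip iso near by blast
qed

text \<open>Being isometric and staying near the vertices are closed conditions for pointwise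
  convergence, so compactness of a product of balls gives the limit line. The conditions
  \<open>A N\<close> become stronger with \<open>N\<close>, so one long segment satisfies any finite
  number of them.\<close>

lemma line_along_word:
  assumes \<sigma>: "range \<sigma> \<subseteq> S"
  shows "\<exists>\<gamma>\<in>geodesic_lines. \<forall>k. dist (\<gamma> (len (word \<sigma> k))) (word \<sigma> k x) \<le> 4 * C + 10 * \<delta>"
proof -
  define E where "E = C + 2 * \<delta>"
  define P where "P = {f :: real \<Rightarrow> 'a. \<forall>t. f t \<in> cball x (4 * E + 2 * \<delta> + \<bar>t\<bar>)}"
  define A where "A N = (\<Inter>s\<in>{s. \<bar>s\<bar> \<le> real N - 2 * E}. \<Inter>t\<in>{t. \<bar>t\<bar> \<le> real N - 2 * E}.
        {f :: real \<Rightarrow> 'a. dist (f s) (f t) = \<bar>s - t\<bar>}) \<inter>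
      (\<Inter>k\<in>{k. k \<le> N \<and> len (word \<sigma> k) \<le> real N - 2 * E}.
        {f. dist (f (len (word \<sigma> k))) (word \<sigma> k x) \<le> 4 * E + 2 * \<delta>})" for N :: nat
  have "P \<inter> (\<Inter>N\<in>UNIV. A N) \<noteq> {}"
  proof (rule compact_imp_fip_image)
    show "compact P" unfolding P_def by (rule compact_Pi_cball[OF proper])
    show "closed (A N)" for N
      unfolding A_def by (intro closed_Int closed_INT ballI closed_dist_at closed_dist_point_at)
    fix I :: "nat set" assume I: "finite I"
    \<comment> \<open>The bound \<open>2 * E \<le> N\<close> makes the vertex condition for
      \<open>k = 0\<close> available, which keeps \<open>f 0\<close> near \<open>x\<close>.\<close>
    obtain n0 :: nat where n0: "2 * E \<le> n0" using real_arch_simple by blast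
    define N where "N = Max (insert n0 I)"
    have N: "n0 \<le> N" "\<And>i. i \<in> I \<Longrightarrow> i \<le> N" using I by (auto simp: N_def)
    obtain f where f: "\<And>s t. dist (f s) (f t) \<le> \<bar>s - t\<bar>"
      "\<And>s t. \<bar>s\<bar> \<le> real N - 2 * E \<Longrightarrow> \<bar>t\<bar> \<le> real N - 2 * E \<Longrightarrow> dist (f s) (f t) = \<bar>s - t\<bar>"
      "\<And>k. k \<le> N \<Longrightarrow> len (word \<sigma> k) \<le> real N - 2 * E \<Longrightarrow>
          dist (f (len (word \<sigma> k))) (word \<sigma> k x) \<le> 4 * E + 2 * \<delta>"
      using segment_along_word[OF \<sigma>, of N] unfolding E_def by blast
    have "f t \<in> cball x (4 * E + 2 * \<delta> + \<bar>t\<bar>)" for t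
      using f(1)[of t 0] f(3)[of 0] n0 N(1) dist_triangle[of x "f t" "f 0"]
      by (simp add: len_def dist_commute)
    moreover have "f \<in> A i" if "i \<in> I" for i
      using N(2)[OF that] unfolding A_def by (auto intro!: f(2,3))
    ultimately show "P \<inter> (\<Inter>i\<in>I. A i) \<noteq> {}" unfolding P_def by blast
  qed
  then obtain f where f: "\<And>N. f \<in> A N" by blast
  have "dist (f s) (f t) = \<bar>s - t\<bar>" for s t
  proof -
    obtain N :: nat where "max \<bar>s\<bar> \<bar>t\<bar> + 2 * E \<le> N" using real_arch_simple by blast
    then have "\<bar>s\<bar> \<le> real N - 2 * E" "\<bar>t\<bar> \<le> real N - 2 * E" by auto
    then show ?thesis using f[of N] unfolding A_def by blast
  qed
  moreover have "dist (f (len (word \<sigma> k))) (word \<sigma> k x) \<le> 4 * C + 10 * \<delta>" for k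
  proof -
    obtain N :: nat where "max (real k) (len (word \<sigma> k) + 2 * E) \<le> N" using real_arch_simple by blast
    then have "k \<le> N" "len (word \<sigma> k) \<le> real N - 2 * E" by auto
    then show ?thesis using f[of N] unfolding A_def by (auto simp: E_def algebra_simps)
  qed
  ultimately show ?thesis by (intro bexI[of _ f]) (auto simp: geodesic_lines_def)
qed

lemma line_near_orbit:
  assumes \<sigma>: "range \<sigma> \<subseteq> S" and \<gamma>: "\<gamma> \<in> geodesic_lines"
    and near: "\<And>k. dist (\<gamma> (len (word \<sigma> k))) (word \<sigma> k x) \<le> R" and t: "0 \<le> t"
  shows "\<exists>g\<in>\<Gamma>. dist (\<gamma> t) (g x) \<le> R + L"
proof -
  have ge: "real k \<le> len (word \<sigma> k)" for k
    using word_dist_ge[OF \<sigma>, of k 0] by (simp add: len_def)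
  obtain n :: nat where "t < n" using reals_Archimedean2 by blast
  then have ex: "t < len (word \<sigma> n)" using ge[of n] by simp
  define m where "m = (LEAST m. t < len (word \<sigma> m))"
  have m: "t < len (word \<sigma> m)" unfolding m_def by (rule LeastI, rule ex)
  then obtain j where j: "m = Suc j" using t by (cases m) (auto simp: len_def)
  then have "\<not> t < len (word \<sigma> j)" unfolding m_def by (metis lessI not_less_Least m_def)
  moreover have "len (word \<sigma> m) \<le> len (word \<sigma> j) + L"
    using len_comp_le[OF word_mem_S[OF \<sigma>], of j "\<sigma> j"] short[OF range_subsetD[OF \<sigma>, of j]] by (simp add: j)
  ultimately have "\<bar>t - len (word \<sigma> j)\<bar> \<le> L" using m by simp
  then have "dist (\<gamma> t) (\<gamma> (len (word \<sigma> j))) \<le> L" using \<gamma> by (simp add: geodesic_lines_def)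
  then have "dist (\<gamma> t) (word \<sigma> j x) \<le> R + L"
    using near[of j] dist_triangle[of "\<gamma> t" "word \<sigma> j x" "\<gamma> (len (word \<sigma> j))"] by simp
  then show ?thesis using word_mem_S[OF \<sigma>] by blast
qed

text \<open>Suppose the words agree before \<open>k\<close>, with common product \<open>w\<close>.
  Both lines reach their next vertex at a time between
  \<open>len w + L - 3 * C - 4 * \<delta>\<close> and \<open>len w + L\<close>. If the lines are
  close, these vertices are less than \<open>2 * R + 2 + 3 * C + 4 * \<delta>\<close> apart, so the
  letters coincide. This threshold does not involve \<open>L\<close>.\<close>

lemma lines_separate_words:
  assumes \<sigma>: "range \<sigma> \<subseteq> S" "range \<sigma>' \<subseteq> S"
    and \<gamma>: "\<gamma> \<in> geodesic_lines" "\<gamma>' \<in> geodesic_lines"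
    and near: "\<And>k. dist (\<gamma> (len (word \<sigma> k))) (word \<sigma> k x) \<le> R"
      "\<And>k. dist (\<gamma>' (len (word \<sigma>' k))) (word \<sigma>' k x) \<le> R"
    and long': "\<And>s. s \<in> S \<Longrightarrow> L - C \<le> len s"
    and sep: "\<And>s s'. \<lbrakk>s \<in> S; s' \<in> S; s \<noteq> s'\<rbrakk> \<Longrightarrow> 2 * R + 2 + 3 * C + 4 * \<delta> \<le> dist (s x) (s' x)"
    and close: "\<And>t. \<lbrakk>0 \<le> t; t \<le> real m * L\<rbrakk> \<Longrightarrow> dist (\<gamma> t) (\<gamma>' t) < 2"
    and "k < m"
  shows "\<sigma> k = \<sigma>' k"
  using \<open>k < m\<close>
proof (induction k rule: less_induct)
  case (less k)
  have eq: "word \<sigma> k = word \<sigma>' k" using less by (intro word_cong) auto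
  define w where "w = word \<sigma> k"
  have w: "w \<in> \<Gamma>" unfolding w_def by (rule word_mem_S[OF \<sigma>(1)])
  define t where "t = len (word \<sigma> (Suc k))"
  define t' where "t' = len (word \<sigma>' (Suc k))"
  have L0: "0 \<le> L" using short[OF range_subsetD[OF \<sigma>(1), of 0]] len_nonneg order_trans by blast
  have bounds: "len w + (L - C) - 2 * (C + 2 * \<delta>) \<le> len (word \<tau> (Suc k))"
    "len (word \<tau> (Suc k)) \<le> len w + L"
    if \<tau>: "range \<tau> \<subseteq> S" and w: "word \<tau> k = w" for \<tau>
  proof -
    show "len w + (L - C) - 2 * (C + 2 * \<delta>) \<le> len (word \<tau> (Suc k))"
      using word_dist[OF \<tau>, of 0 k "Suc k"] dist_word_Suc[OF \<tau>, of k] long'[OF range_subsetD[OF \<tau>, of k]] w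
      by (simp add: len_def del: word.simps(2))
    show "len (word \<tau> (Suc k)) \<le> len w + L"
      using len_comp_le[OF word_mem_S[OF \<tau>], of k "\<tau> k"] short[OF range_subsetD[OF \<tau>, of k]] w by simp
  qed
  have tt: "\<bar>t - t'\<bar> \<le> 3 * C + 4 * \<delta>"
    using bounds[OF \<sigma>(1)] bounds[OF \<sigma>(2)] eq by (simp add: t_def t'_def w_def del: word.simps)
  have "Suc k * L \<le> real m * L" using less.prems L0 by (intro mult_right_mono) auto
  then have tm: "0 \<le> t" "t \<le> real m * L"
    using len_word_le[OF \<sigma>(1), of "Suc k"] by (simp_all add: t_def len_nonneg del: word.simps)
  show ?case
  proof (rule ccontr)
    assume "\<sigma> k \<noteq> \<sigma>' k"
    then have "2 * R + 2 + 3 * C + 4 * \<delta> \<le> dist (\<sigma> k x) (\<sigma>' k x)"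
      using sep range_subsetD[OF \<sigma>(1)] range_subsetD[OF \<sigma>(2)] by blast
    also have "\<dots> = dist (word \<sigma> (Suc k) x) (word \<sigma>' (Suc k) x)"
      using isom[OF w] eq by (simp add: w_def)
    also have "\<dots> < R + 2 + (3 * C + 4 * \<delta>) + R"
    proof -
      let ?q = "word \<sigma> (Suc k) x" and ?q' = "word \<sigma>' (Suc k) x"
      have 1: "dist (\<gamma> t) ?q \<le> R" unfolding t_def by (rule near)
      have 2: "dist (\<gamma>' t') ?q' \<le> R" unfolding t'_def by (rule near)
      have 3: "dist (\<gamma> t) (\<gamma>' t) < 2" using close tm by blast
      have 4: "dist (\<gamma>' t) (\<gamma>' t') \<le> 3 * C + 4 * \<delta>" using \<gamma>(2) tt by (simp add: geodesic_lines_def)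
      have "dist ?q ?q' \<le> dist (\<gamma> t) ?q + dist (\<gamma> t) (\<gamma>' t) + dist (\<gamma>' t) (\<gamma>' t') + dist (\<gamma>' t') ?q'"
        by metric
      then show ?thesis using 1 2 3 4 by linarith
    qed
    finally show False by simp
  qed
qed

end

lemma schottky_lines:
  assumes geom: "proper_space TYPE('a)" "geodesic_space TYPE('a)"
    and "non_elementary \<Gamma>" and h: "0 < h" "ereal h < critical_exponent \<Gamma> x"
  obtains L :: real and S :: "('a \<Rightarrow> 'a) set" and \<gamma> :: "(nat \<Rightarrow> 'a \<Rightarrow> 'a) \<Rightarrow> real \<Rightarrow> 'a" and Q :: real
  where "0 < L" "finite S" "exp (h * L) \<le> card S"
    "\<And>\<sigma>. range \<sigma> \<subseteq> S \<Longrightarrow> \<gamma> \<sigma> \<in> geodesic_lines"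
    "\<And>\<sigma>. range \<sigma> \<subseteq> S \<Longrightarrow> dist (\<gamma> \<sigma> 0) x \<le> Q"
    "\<And>\<sigma> t. \<lbrakk>range \<sigma> \<subseteq> S; 0 \<le> t\<rbrakk> \<Longrightarrow> \<exists>g\<in>\<Gamma>. dist (\<gamma> \<sigma> t) (g x) \<le> Q"
    "\<And>\<sigma> \<sigma>' m k. \<lbrakk>range \<sigma> \<subseteq> S; range \<sigma>' \<subseteq> S;
        \<And>t. \<lbrakk>0 \<le> t; t \<le> real m * L\<rbrakk> \<Longrightarrow> dist (\<gamma> \<sigma> t) (\<gamma> \<sigma>' t) < 2; k < m\<rbrakk> \<Longrightarrow> \<sigma> (k::nat) = \<sigma>' k"
proof -
  obtain C where "0 \<le> C" and C: "\<And>D L0. \<exists>L\<ge>L0. \<exists>S. finite S \<and> S \<subseteq> \<Gamma> \<and>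
      (\<forall>s\<in>S. L - C \<le> len s \<and> len s \<le> L) \<and>
      (\<forall>s\<in>S. \<forall>s'\<in>S. gp (ginv s) s' \<le> C) \<and>
      (\<forall>s\<in>S. \<forall>s'\<in>S. s \<noteq> s' \<longrightarrow> D \<le> dist (s x) (s' x)) \<and>
      exp (h * L) \<le> card S"
    using schottky[OF assms] by blast
  define R where "R = 4 * C + 10 * \<delta>"
  \<comment> \<open>The bound on \<open>L\<close> turns \<open>L - C \<le> len s\<close> into the
    letter length that words require; the separation is the threshold at which close lines determine
    the letter.\<close>
  obtain L S where L: "3 * C + 4 * \<delta> + 1 \<le> L" and S: "finite S" "S \<subseteq> \<Gamma>"
      "\<forall>s\<in>S. L - C \<le> len s \<and> len s \<le> L" "\<forall>s\<in>S. \<forall>s'\<in>S. gp (ginv s) s' \<le> C"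
      "\<forall>s\<in>S. \<forall>s'\<in>S. s \<noteq> s' \<longrightarrow> 2 * R + 2 + 3 * C + 4 * \<delta> \<le> dist (s x) (s' x)"
      "exp (h * L) \<le> card S"
    using C[of "3 * C + 4 * \<delta> + 1" "2 * R + 2 + 3 * C + 4 * \<delta>"] by blast
  note S = S(1,2) S(3)[rule_format, THEN conjunct1] S(3)[rule_format, THEN conjunct2]
    S(4)[rule_format] S(5)[rule_format] S(6)
  have long: "2 * C + 4 * \<delta> + 1 \<le> len s" if "s \<in> S" for s using S(3)[OF that] L by simp
  define \<gamma> where "\<gamma> \<sigma> = (SOME \<gamma>. \<gamma> \<in> geodesic_lines \<and>
    (\<forall>k. dist (\<gamma> (len (word \<sigma> k))) (word \<sigma> k x) \<le> R))" for \<sigma>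
  have \<gamma>: "\<gamma> \<sigma> \<in> geodesic_lines" "dist (\<gamma> \<sigma> (len (word \<sigma> k))) (word \<sigma> k x) \<le> R"
    if "range \<sigma> \<subseteq> S" for \<sigma> k
  proof -
    have "\<exists>\<gamma>. \<gamma> \<in> geodesic_lines \<and> (\<forall>k. dist (\<gamma> (len (word \<sigma> k))) (word \<sigma> k x) \<le> R)"
      using line_along_word[OF S(2) S(5) long S(4) geom that] unfolding R_def by blast
    from someI_ex[OF this] have "\<gamma> \<sigma> \<in> geodesic_lines \<and>
        (\<forall>k. dist (\<gamma> \<sigma> (len (word \<sigma> k))) (word \<sigma> k x) \<le> R)"
      unfolding \<gamma>_def .
    then show "\<gamma> \<sigma> \<in> geodesic_lines" "dist (\<gamma> \<sigma> (len (word \<sigma> k))) (word \<sigma> k x) \<le> R" by blast+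
  qed
  have "0 < L" using L \<open>0 \<le> C\<close> delta_nonneg by simp
  show thesis
  proof (rule that[of L S \<gamma> "R + L"])
    show "0 < L" by fact
    show "\<gamma> \<sigma> \<in> geodesic_lines" if "range \<sigma> \<subseteq> S" for \<sigma> using \<gamma>(1)[OF that] .
    show "dist (\<gamma> \<sigma> 0) x \<le> R + L" if "range \<sigma> \<subseteq> S" for \<sigma>
      using \<gamma>(2)[OF that, of 0] \<open>0 < L\<close> by (simp add: len_def)
    show "\<exists>g\<in>\<Gamma>. dist (\<gamma> \<sigma> t) (g x) \<le> R + L" if "range \<sigma> \<subseteq> S" "0 \<le> t" for \<sigma> t
      by (rule line_near_orbit[OF S(2) S(5) long S(4) geom that(1) \<gamma>(1)[OF that(1)] \<gamma>(2)[OF that(1)] that(2)])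
    show "\<sigma> k = \<sigma>' k" if \<sigma>: "range \<sigma> \<subseteq> S" "range \<sigma>' \<subseteq> S"
      and *: "\<And>t. \<lbrakk>0 \<le> t; t \<le> real m * L\<rbrakk> \<Longrightarrow> dist (\<gamma> \<sigma> t) (\<gamma> \<sigma>' t) < 2" "k < m" for \<sigma> \<sigma>' m k
      by (rule lines_separate_words[where \<gamma> = "\<gamma> \<sigma>" and \<gamma>' = "\<gamma> \<sigma>'" and m = m
          and S = S and C = C and L = L and R = R];
        (fact S(2) geom \<sigma> *(2) | rule S(3) S(4) S(5) S(6) long \<gamma> *(1));
        (assumption | fact \<sigma>)?)
  qed (use S in auto)
qed

end

section \<open>The space of geodesic lines and its quotient\<close>

lemma openin_geod_basic:
  assumes "\<gamma> \<in> geodesic_lines" "compact K" "\<epsilon> > 0"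
  shows "openin geod_topology {\<eta> \<in> geodesic_lines. \<forall>t\<in>K. dist (\<gamma> t) (\<eta> t) < \<epsilon>}"
  unfolding geod_topology_def by (rule topology_generated_by_Basis) (use assms in blast)

lemma continuous_map_geod_topology:
  fixes f :: "'b \<Rightarrow> real \<Rightarrow> 'a::metric_space"
  assumes "f ` topspace X \<subseteq> geodesic_lines"
    and "\<And>\<gamma> K \<epsilon>. \<lbrakk>\<gamma> \<in> geodesic_lines; compact K; \<epsilon> > 0\<rbrakk> \<Longrightarrow>
      openin X {y \<in> topspace X. \<forall>t\<in>K. dist (\<gamma> t) (f y t) < \<epsilon>}"
  shows "continuous_map X geod_topology f"
  unfolding geod_topology_def
proof (rule continuous_on_generated_topo)
  fix U assume "U \<in> {{\<eta> \<in> geodesic_lines. \<forall>t\<in>K. dist (\<gamma> t) (\<eta> t) < \<epsilon>} |\<gamma> K \<epsilon>.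
    \<gamma> \<in> (geodesic_lines :: (real \<Rightarrow> 'a) set) \<and> compact K \<and> \<epsilon> > 0}"
  then obtain \<gamma> K \<epsilon> where *: "U = {\<eta> \<in> geodesic_lines. \<forall>t\<in>K. dist (\<gamma> t) (\<eta> t) < \<epsilon>}"
    "\<gamma> \<in> geodesic_lines" "compact K" "\<epsilon> > 0" by blast
  have "f -` U \<inter> topspace X = {y \<in> topspace X. \<forall>t\<in>K. dist (\<gamma> t) (f y t) < \<epsilon>}"
    using assms(1) *(1) by auto
  then show "openin X (f -` U \<inter> topspace X)" using assms(2)[OF *(2-4)] by simp
next
  have "(geodesic_lines :: (real \<Rightarrow> 'a) set) = topspace geod_topology" by simp
  also have "\<dots> = \<Union> {{\<eta> \<in> geodesic_lines. \<forall>t\<in>K. dist (\<gamma> t) (\<eta> t) < \<epsilon>} |\<gamma> K \<epsilon>.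
    \<gamma> \<in> geodesic_lines \<and> compact K \<and> \<epsilon> > 0}"
    unfolding geod_topology_def topology_generated_by_topspace ..
  finally show "f ` topspace X \<subseteq> \<Union> {{\<eta> \<in> geodesic_lines. \<forall>t\<in>K. dist (\<gamma> t) (\<eta> t) < \<epsilon>} |\<gamma> K \<epsilon>.
    \<gamma> \<in> (geodesic_lines :: (real \<Rightarrow> 'a) set) \<and> compact K \<and> \<epsilon> > 0}"
    using assms(1) by simp
qed

lemma geod_flow_mem: "\<gamma> \<in> geodesic_lines \<Longrightarrow> geod_flow t \<gamma> \<in> geodesic_lines"
  by (auto simp: geodesic_lines_def geod_flow_def)

lemma continuous_map_geod_flow: "continuous_map geod_topology geod_topology (geod_flow t)"
proof (rule continuous_map_geod_topology)
  show "geod_flow t ` topspace geod_topology \<subseteq> geodesic_lines" using geod_flow_mem by auto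
  fix \<gamma> :: "real \<Rightarrow> 'a" and K :: "real set" and \<epsilon> :: real
  assume *: "\<gamma> \<in> geodesic_lines" "compact K" "\<epsilon> > 0"
  have "openin geod_topology {\<eta> \<in> geodesic_lines. \<forall>s\<in>(+) t ` K. dist (geod_flow (- t) \<gamma> s) (\<eta> s) < \<epsilon>}"
    by (rule openin_geod_basic) (use * in \<open>auto intro: geod_flow_mem compact_translation\<close>)
  also have "{\<eta> \<in> geodesic_lines. \<forall>s\<in>(+) t ` K. dist (geod_flow (- t) \<gamma> s) (\<eta> s) < \<epsilon>}
      = {\<eta> \<in> topspace geod_topology. \<forall>s\<in>K. dist (\<gamma> s) (geod_flow t \<eta> s) < \<epsilon>}"
    by (auto simp: geod_flow_def add.commute)
  finally show "openin geod_topology {\<eta> \<in> topspace geod_topology. \<forall>s\<in>K. dist (\<gamma> s) (geod_flow t \<eta> s) < \<epsilon>}" .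
qed

text \<open>Lines are 1-Lipschitz, so on them pointwise convergence is already uniform on compact sets.\<close>

lemma continuous_map_pointwise_geod:
  "continuous_map (subtopology euclidean (geodesic_lines :: (real \<Rightarrow> 'a::metric_space) set)) geod_topology id"
proof (rule continuous_map_geod_topology)
  fix \<gamma> :: "real \<Rightarrow> 'a" and K :: "real set" and \<epsilon> :: real
  assume \<gamma>: "\<gamma> \<in> geodesic_lines" and K: "compact K" and \<epsilon>: "\<epsilon> > 0"
  let ?G = "geodesic_lines :: (real \<Rightarrow> 'a) set"
  let ?U = "{\<eta> \<in> ?G. \<forall>t\<in>K. dist (\<gamma> t) (\<eta> t) < \<epsilon>}"
  have cont: "continuous_on K \<zeta>" if "\<zeta> \<in> ?G" for \<zeta>
    unfolding continuous_on_iff using that by (auto simp: geodesic_lines_def dist_real_def)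
  have "openin (subtopology euclidean ?G) ?U"
  proof (subst openin_subopen, intro ballI)
    fix \<eta> assume \<eta>: "\<eta> \<in> ?U"
    have "\<exists>d>0. \<forall>t\<in>K. dist (\<gamma> t) (\<eta> t) \<le> \<epsilon> - d"
    proof (cases "K = {}")
      case True then show ?thesis by (intro exI[of _ 1]) auto
    next
      case False
      have "continuous_on K (\<lambda>t. dist (\<gamma> t) (\<eta> t))"
        using \<eta> \<gamma> by (intro continuous_on_dist cont) auto
      from continuous_attains_sup[OF K False this] obtain m
        where "m \<in> K" "\<And>t. t \<in> K \<Longrightarrow> dist (\<gamma> t) (\<eta> t) \<le> dist (\<gamma> m) (\<eta> m)" by blast
      then show ?thesis using \<eta> by (intro exI[of _ "\<epsilon> - dist (\<gamma> m) (\<eta> m)"]) auto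
    qed
    then obtain d where d: "d > 0" "\<And>t. t \<in> K \<Longrightarrow> dist (\<gamma> t) (\<eta> t) \<le> \<epsilon> - d" by blast
    have "K \<subseteq> (\<Union>t\<in>K. ball t (d/3))" using d(1) by force
    then obtain F where F: "F \<subseteq> K" "finite F" "K \<subseteq> (\<Union>t\<in>F. ball t (d/3))"
      using compactE_image[OF K, of K "\<lambda>t. ball t (d/3)"] by (metis open_ball)
    define V where "V = (\<Inter>t\<in>F. {f :: real \<Rightarrow> 'a. dist (\<eta> t) (f t) < d/3})"
    have "open V"
      unfolding V_def
      by (intro open_INT F(2) ballI open_Collect_less continuous_intros) auto
    then have "openin (subtopology euclidean ?G) (?G \<inter> V)"
      by (simp add: openin_open_Int)
    moreover have "\<eta> \<in> ?G \<inter> V" using \<eta> d(1) by (simp add: V_def)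
    moreover have "?G \<inter> V \<subseteq> ?U"
    proof safe
      fix f t assume f: "f \<in> ?G" "f \<in> V" and t: "t \<in> K"
      obtain s where s: "s \<in> F" "\<bar>s - t\<bar> < d/3" using F(3) t by (force simp: dist_real_def)
      have 1: "dist (\<eta> s) (f s) < d/3" using f(2) s(1) by (simp add: V_def)
      have 2: "dist (\<eta> s) (\<eta> t) = \<bar>s - t\<bar>" "dist (f s) (f t) = \<bar>s - t\<bar>"
        using \<eta> f(1) by (simp_all add: geodesic_lines_def)
      have "dist (\<gamma> t) (f t) \<le> dist (\<gamma> t) (\<eta> t) + dist (\<eta> s) (\<eta> t) + dist (\<eta> s) (f s) + dist (f s) (f t)"
        by metric
      then show "dist (\<gamma> t) (f t) < \<epsilon>" using 1 2 s(2) d(2)[OF t] by linarith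
    qed
    ultimately show "\<exists>T. openin (subtopology euclidean ?G) T \<and> \<eta> \<in> T \<and> T \<subseteq> ?U" by blast
  qed
  then show "openin (subtopology euclidean ?G)
      {y \<in> topspace (subtopology euclidean ?G). \<forall>t\<in>K. dist (\<gamma> t) (id y t) < \<epsilon>}"
    by simp
qed auto

text \<open>Bounding a line at time 0 confines its value at time \<open>t\<close> to a ball of
  radius \<open>R + \<bar>t\<bar>\<close>, and being a line is a pointwise closed condition.
  Compactness for pointwise convergence then carries over to \<open>geod_topology\<close>.\<close>

lemma compactin_geod_topology:
  assumes "proper_space TYPE('a::metric_space)"
  shows "compactin geod_topology {\<gamma> \<in> geodesic_lines. dist (y::'a) (\<gamma> 0) \<le> R}"
proof -
  let ?Q = "{\<gamma> \<in> geodesic_lines. dist y (\<gamma> 0) \<le> R}"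
  have "closed ?Q"
  proof -
    have "?Q = (\<Inter>s. \<Inter>t. {f. dist (f s) (f t) = \<bar>s - t\<bar>}) \<inter> {f. dist (f 0) y \<le> R}"
      by (auto simp: geodesic_lines_def dist_commute)
    then show ?thesis by (auto intro!: closed_INT closed_Int closed_dist_at closed_dist_point_at)
  qed
  moreover have "?Q \<subseteq> {f. \<forall>t. f t \<in> cball y (R + \<bar>t\<bar>)}"
  proof safe
    fix f t assume "f \<in> geodesic_lines" "dist y (f 0) \<le> R"
    then show "f t \<in> cball y (R + \<bar>t\<bar>)"
      using dist_triangle[of y "f t" "f 0"] by (simp add: geodesic_lines_def)
  qed
  then have "{f. \<forall>t. f t \<in> cball y (R + \<bar>t\<bar>)} \<inter> ?Q = ?Q" by (rule inf.absorb2)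
  ultimately have "compact ?Q"
    using compact_Int_closed[OF compact_Pi_cball[OF assms, of y "\<lambda>t. R + \<bar>t\<bar>"], of ?Q] by simp
  then have "compactin (subtopology euclidean geodesic_lines) ?Q"
    by (auto simp: compactin_subtopology)
  from image_compactin[OF this continuous_map_pointwise_geod] show ?thesis by simp
qed

lemma line_orbit_eq_iff:
  fixes \<Gamma> :: "('a::metric_space \<Rightarrow> 'a) set"
  assumes "id \<in> \<Gamma>" "\<And>g h. \<lbrakk>g \<in> \<Gamma>; h \<in> \<Gamma>\<rbrakk> \<Longrightarrow> g \<circ> h \<in> \<Gamma>"
    "\<And>g. g \<in> \<Gamma> \<Longrightarrow> \<exists>h\<in>\<Gamma>. h \<circ> g = id"
  shows "line_orbit \<Gamma> \<gamma> = line_orbit \<Gamma> \<eta> \<longleftrightarrow> (\<exists>g\<in>\<Gamma>. \<gamma> = g \<circ> \<eta>)"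
proof
  assume "line_orbit \<Gamma> \<gamma> = line_orbit \<Gamma> \<eta>"
  moreover have "\<gamma> \<in> line_orbit \<Gamma> \<gamma>"
    unfolding line_orbit_def using assms(1) by (metis id_comp image_eqI)
  ultimately show "\<exists>g\<in>\<Gamma>. \<gamma> = g \<circ> \<eta>" by (auto simp: line_orbit_def)
next
  assume "\<exists>g\<in>\<Gamma>. \<gamma> = g \<circ> \<eta>"
  then obtain g where g: "g \<in> \<Gamma>" "\<gamma> = g \<circ> \<eta>" by blast
  obtain k where k: "k \<in> \<Gamma>" "k \<circ> g = id" using assms(3)[OF g(1)] by blast
  show "line_orbit \<Gamma> \<gamma> = line_orbit \<Gamma> \<eta>"
    unfolding line_orbit_def
  proof safe
    fix h assume "h \<in> \<Gamma>"
    then show "h \<circ> \<gamma> \<in> (\<lambda>g. g \<circ> \<eta>) ` \<Gamma>"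
      using g assms(2) by (metis comp_assoc image_eqI)
    have "(h \<circ> k) \<circ> \<gamma> = h \<circ> ((k \<circ> g) \<circ> \<eta>)" by (simp add: g(2) comp_assoc)
    then have "h \<circ> \<eta> = (h \<circ> k) \<circ> \<gamma>" using k(2) by simp
    then show "h \<circ> \<eta> \<in> (\<lambda>g. g \<circ> \<gamma>) ` \<Gamma>"
      using \<open>h \<in> \<Gamma>\<close> k(1) assms(2) by blast
  qed
qed

lemma continuous_map_line_orbit:
  "continuous_map geod_topology (geod_quotient \<Gamma>) (line_orbit \<Gamma>)"
  unfolding geod_quotient_def by (rule quotient_imp_continuous_map[OF quotient_map_quotient_topology])

lemma topspace_geod_quotient: "topspace (geod_quotient \<Gamma>) = line_orbit \<Gamma> ` geodesic_lines"
  by (simp add: geod_quotient_def)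

lemma continuous_map_quotient_flow:
  "continuous_map (geod_quotient \<Gamma>) (geod_quotient \<Gamma>) (quotient_flow t)"
proof -
  have "continuous_map geod_topology (geod_quotient \<Gamma>) (line_orbit \<Gamma> \<circ> geod_flow t)"
    by (rule continuous_map_compose[OF continuous_map_geod_flow continuous_map_line_orbit])
  also have "line_orbit \<Gamma> \<circ> geod_flow t = quotient_flow t \<circ> line_orbit \<Gamma>"
    by (simp add: fun_eq_iff quotient_flow_line_orbit)
  finally show ?thesis
    by (metis continuous_compose_quotient_map geod_quotient_def quotient_map_quotient_topology)
qed

lemma quotient_flow_funpow: "(quotient_flow 1 ^^ i) (line_orbit \<Gamma> \<gamma>) = line_orbit \<Gamma> (geod_flow (real i) \<gamma>)"
proof (induction i)
  case (Suc i)
  have "geod_flow 1 (geod_flow (real i) \<gamma>) = geod_flow (real (Suc i)) \<gamma>"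
    by (auto simp: geod_flow_def fun_eq_iff algebra_simps)
  then show ?case using Suc by (simp add: quotient_flow_line_orbit)
qed (simp add: geod_flow_def)

section \<open>Entropy\<close>

lemma dyn_dist_less_iff:
  "0 < n \<Longrightarrow> dyn_dist \<rho> T n y z < r \<longleftrightarrow> (\<forall>i<n. \<rho> ((T ^^ i) y) ((T ^^ i) z) < r)"
  unfolding dyn_dist_def by (subst Max_less_iff) auto

text \<open>\<open>Lim\<close> says nothing until a limit is known to exist. Here the values
  increase as \<open>r\<close> decreases, so they converge to their supremum.\<close>

lemma antimono_le_Lim_at_right:
  fixes f :: "real \<Rightarrow> ereal"
  assumes anti: "\<And>r s. \<lbrakk>0 < r; r \<le> s\<rbrakk> \<Longrightarrow> f s \<le> f r" and "0 < r"
  shows "f r \<le> Lim (at_right 0) f"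
proof -
  have "(f \<longlongrightarrow> (SUP s\<in>{0<..}. f s)) (at_right 0)"
  proof (rule increasing_tendsto)
    show "\<forall>\<^sub>F s in at_right 0. f s \<le> (SUP s\<in>{0<..}. f s)"
      using eventually_at_right_less[of 0] by eventually_elim (auto intro: SUP_upper)
    fix a assume "a < (SUP s\<in>{0<..}. f s)"
    then obtain s where s: "0 < s" "a < f s" by (auto simp: less_SUP_iff)
    have "\<forall>\<^sub>F u in at_right 0. u \<in> {0<..<s}" by (rule eventually_at_rightI[OF _ s(1)])
    then show "\<forall>\<^sub>F u in at_right 0. a < f u"
    proof eventually_elim
      case (elim u)
      then show ?case using anti[of u s] s(2) by (auto intro: less_le_trans)
    qed
  qed
  then have "Lim (at_right 0) f = (SUP s\<in>{0<..}. f s)"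
    by (intro tendsto_Lim) simp_all
  then show ?thesis using \<open>0 < r\<close> by (auto intro: SUP_upper)
qed

context Metric_space
begin

context
  fixes T :: "'a \<Rightarrow> 'a" and K :: "'a set"
  assumes T: "continuous_map mtopology mtopology T" and K: "compactin mtopology K"
begin

lemma continuous_map_iterate: "continuous_map mtopology mtopology (T ^^ i)"
proof (induction i)
  case (Suc i)
  show ?case unfolding funpow.simps by (rule continuous_map_compose[OF Suc T])
qed (simp add: id_def)

text \<open>Shows that the \<open>LEAST\<close> in \<open>covering_number\<close> is attained. For
  \<open>n = 0\<close> the maximum in \<open>dyn_dist\<close> would range over an empty set.\<close>

lemma finite_dyn_cover:
  assumes "0 < n" "0 < r"
  shows "\<exists>C. C \<subseteq> M \<and> finite C \<and> K \<subseteq> (\<Union>c\<in>C. {y \<in> M. dyn_dist d T n c y < r})"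
proof -
  let ?B = "\<lambda>c. {y \<in> M. dyn_dist d T n c y < r}"
  have KM: "K \<subseteq> M" using compactin_subset_topspace[OF K] by simp
  have iter: "(T ^^ i) y \<in> M" if "y \<in> M" for i y
    using continuous_map_image_subset_topspace[OF continuous_map_iterate[of i]] that by auto
  have "openin mtopology (?B c)" if "c \<in> K" for c
  proof -
    have "?B c = (\<Inter>i\<in>{..<n}. {y \<in> topspace mtopology. (T ^^ i) y \<in> mball ((T ^^ i) c) r})"
      using iter that KM \<open>0 < n\<close> by (auto simp: dyn_dist_less_iff)
    also have "openin mtopology \<dots>"
    proof (rule openin_Inter)
      fix U assume "U \<in> (\<lambda>i. {y \<in> topspace mtopology. (T ^^ i) y \<in> mball ((T ^^ i) c) r}) ` {..<n}"
      then obtain i where "U = {y \<in> topspace mtopology. (T ^^ i) y \<in> mball ((T ^^ i) c) r}" by blast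
      then show "openin mtopology U"
        using openin_continuous_map_preimage[OF continuous_map_iterate openin_mball] by simp
    qed (use \<open>0 < n\<close> in auto)
    finally show ?thesis .
  qed
  moreover have "K \<subseteq> \<Union> (?B ` K)"
  proof
    fix c assume "c \<in> K"
    then have "c \<in> ?B c" using KM iter assms by (auto simp: dyn_dist_less_iff)
    then show "c \<in> \<Union> (?B ` K)" using \<open>c \<in> K\<close> by blast
  qed
  ultimately obtain \<F> where \<F>: "finite \<F>" "\<F> \<subseteq> ?B ` K" "K \<subseteq> \<Union> \<F>"
    using compactinD[OF K, of "?B ` K"] by (metis (no_types, lifting) imageE)
  then obtain C where "C \<subseteq> K" "finite C" "\<F> = ?B ` C" by (meson finite_subset_image)
  then show ?thesis using \<F>(3) KM by blast
qed

lemma covering_number_attained: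
  assumes "0 < n" "0 < r"
  shows "\<exists>C. C \<subseteq> M \<and> finite C \<and> card C = covering_number M (dyn_dist d T n) K r
    \<and> K \<subseteq> (\<Union>c\<in>C. {y \<in> M. dyn_dist d T n c y < r})"
proof -
  have "\<exists>k C. C \<subseteq> M \<and> finite C \<and> card C = k \<and> K \<subseteq> (\<Union>c\<in>C. {y \<in> M. dyn_dist d T n c y < r})"
    using finite_dyn_cover[OF assms] by blast
  from LeastI_ex[OF this] show ?thesis unfolding covering_number_def .
qed

lemma covering_number_antimono:
  assumes "0 < n" "0 < r" "r \<le> s"
  shows "covering_number M (dyn_dist d T n) K s \<le> covering_number M (dyn_dist d T n) K r"
proof -
  obtain C where C: "C \<subseteq> M" "finite C" "card C = covering_number M (dyn_dist d T n) K r"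
    "K \<subseteq> (\<Union>c\<in>C. {y \<in> M. dyn_dist d T n c y < r})"
    using covering_number_attained[OF assms(1,2)] by blast
  have "(\<Union>c\<in>C. {y \<in> M. dyn_dist d T n c y < r}) \<subseteq> (\<Union>c\<in>C. {y \<in> M. dyn_dist d T n c y < s})"
    using order_less_le_trans[OF _ assms(3)] by blast
  then have cov: "K \<subseteq> (\<Union>c\<in>C. {y \<in> M. dyn_dist d T n c y < s})" using C(4) by (rule subset_trans[rotated])
  show ?thesis unfolding C(3)[symmetric]
    unfolding covering_number_def by (rule Least_le) (intro exI[of _ C] conjI C(1,2) refl cov)
qed

text \<open>Lets a single radius bound the limit from below. A nonempty \<open>K\<close> keeps the
  covering numbers positive, where \<open>ln\<close> is monotone.\<close>

lemma limsup_covering_le_Lim: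
  assumes "K \<noteq> {}" "0 < r"
  defines "f \<equiv> \<lambda>r::real. limsup (\<lambda>n. ereal (ln (real (covering_number M (dyn_dist d T n) K r)) / real n))"
  shows "f r \<le> Lim (at_right 0) f"
proof (rule antimono_le_Lim_at_right[OF _ assms(2)])
  fix r s :: real assume rs: "0 < r" "r \<le> s"
  have pos: "0 < covering_number M (dyn_dist d T n) K s" if "0 < n" for n
  proof -
    have "0 < s" using rs by simp
    from covering_number_attained[OF that this] show ?thesis
      using assms(1) by (metis (no_types, lifting) UN_empty card_gt_0_iff subset_empty)
  qed
  have "\<forall>\<^sub>F n in sequentially. ereal (ln (real (covering_number M (dyn_dist d T n) K s)) / real n)
      \<le> ereal (ln (real (covering_number M (dyn_dist d T n) K r)) / real n)"
    using eventually_gt_at_top[of 0]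
  proof eventually_elim
    case (elim n)
    have "ln (real (covering_number M (dyn_dist d T n) K s)) \<le> ln (real (covering_number M (dyn_dist d T n) K r))"
      using covering_number_antimono[OF elim rs] pos[OF elim] by simp
    then show ?case using elim by (simp add: divide_right_mono)
  qed
  then show "f s \<le> f r" unfolding f_def by (rule Limsup_mono)
qed

end

end

section \<open>Tracking in the quotient and the lower bound for the entropy\<close>

context discrete_hyperbolic_group
begin

lemma line_orbit_eq_iff': "line_orbit \<Gamma> \<gamma> = line_orbit \<Gamma> \<eta> \<longleftrightarrow> (\<exists>g\<in>\<Gamma>. \<gamma> = g \<circ> \<eta>)"
proof (rule line_orbit_eq_iff)
  show "\<exists>h\<in>\<Gamma>. h \<circ> g = id" if "g \<in> \<Gamma>" for g
    using that by (intro bexI[of _ "ginv g"]) (auto simp: fun_eq_iff)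
qed auto

lemma comp_geodesic_line: "\<lbrakk>g \<in> \<Gamma>; \<gamma> \<in> geodesic_lines\<rbrakk> \<Longrightarrow> g \<circ> \<gamma> \<in> geodesic_lines"
  by (simp add: geodesic_lines_def isom)

text \<open>The compact set on which entropy is measured. It need not be invariant under the flow,
  but the lines along words remain in it for all nonnegative times.\<close>

definition thick :: "real \<Rightarrow> (real \<Rightarrow> 'a) set set" where
  "thick Q = line_orbit \<Gamma> ` {\<gamma> \<in> geodesic_lines. dist x (\<gamma> 0) \<le> Q}"

lemma thickI:
  assumes "\<gamma> \<in> geodesic_lines" "\<exists>g\<in>\<Gamma>. dist (\<gamma> 0) (g x) \<le> Q"
  shows "line_orbit \<Gamma> \<gamma> \<in> thick Q"
proof -
  obtain g where g: "g \<in> \<Gamma>" "dist (\<gamma> 0) (g x) \<le> Q" using assms(2) by blast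
  let ?\<eta> = "ginv g \<circ> \<gamma>"
  have "?\<eta> \<in> geodesic_lines" using comp_geodesic_line g(1) assms(1) by blast
  moreover have "dist x (?\<eta> 0) \<le> Q" using g by (simp add: dist_inv dist_commute[of x])
  moreover have "line_orbit \<Gamma> ?\<eta> = line_orbit \<Gamma> \<gamma>"
    unfolding line_orbit_eq_iff' using g(1) by blast
  ultimately show ?thesis unfolding thick_def by (metis (mono_tags, lifting) image_eqI mem_Collect_eq)
qed

lemma compactin_thick:
  assumes "proper_space TYPE('a)"
  shows "compactin (geod_quotient \<Gamma>) (thick Q)"
  unfolding thick_def
  by (rule image_compactin[OF compactin_geod_topology[OF assms] continuous_map_line_orbit])

text \<open>Allowing an arbitrary \<open>g\<close> makes the set of lines a union of open sets that
  is invariant under the group, so its image is open in the quotient.\<close>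

lemma openin_tracking:
  assumes \<gamma>: "\<gamma> \<in> geodesic_lines" and "\<epsilon> > 0"
  shows "openin (geod_quotient \<Gamma>)
    (line_orbit \<Gamma> ` {\<eta> \<in> geodesic_lines. \<exists>g\<in>\<Gamma>. \<forall>t\<in>{0..W}. dist (\<gamma> t) (g (\<eta> t)) < \<epsilon>})"
    (is "openin _ (_ ` ?U)")
proof -
  have "?U = (\<Union>g\<in>\<Gamma>. {\<eta> \<in> geodesic_lines. \<forall>t\<in>{0..W}. dist ((ginv g \<circ> \<gamma>) t) (\<eta> t) < \<epsilon>})"
    by (auto simp: dist_inv)
  also have "openin geod_topology \<dots>"
    by (rule openin_Union)
      (use assms in \<open>auto simp del: comp_apply intro!: openin_geod_basic comp_geodesic_line\<close>)
  finally have "openin geod_topology ?U" .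
  moreover have "{\<eta> \<in> topspace geod_topology. line_orbit \<Gamma> \<eta> \<in> line_orbit \<Gamma> ` ?U} = ?U"
  proof -
    have "\<eta> \<in> ?U" if *: "\<eta> \<in> geodesic_lines" "line_orbit \<Gamma> \<eta> = line_orbit \<Gamma> \<theta>" "\<theta> \<in> ?U" for \<eta> \<theta>
    proof -
      obtain k where k: "k \<in> \<Gamma>" "\<theta> = k \<circ> \<eta>" using *(2) line_orbit_eq_iff'[of \<theta> \<eta>] by auto
      obtain g where "g \<in> \<Gamma>" "\<forall>t\<in>{0..W}. dist (\<gamma> t) (g (\<theta> t)) < \<epsilon>" using *(3) by blast
      then have "g \<circ> k \<in> \<Gamma>" "\<forall>t\<in>{0..W}. dist (\<gamma> t) ((g \<circ> k) (\<eta> t)) < \<epsilon>" using k by auto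
      then show ?thesis using *(1) by blast
    qed
    then show ?thesis by auto
  qed
  ultimately show ?thesis
    unfolding geod_quotient_def openin_quotient_topology by (auto simp: image_mono)
qed

text \<open>The radius is a Lebesgue number of the cover of \<open>thick Q\<close> by tracking sets.
  Both orbits then lie in one such set, so that both lines follow the same \<open>\<gamma>\<close>
  within \<open>1/2\<close> after translation.\<close>

lemma close_orbits_track:
  assumes proper: "proper_space TYPE('a)"
    and \<rho>: "Metric_space (topspace (geod_quotient \<Gamma>)) \<rho>"
      "Metric_space.mtopology (topspace (geod_quotient \<Gamma>)) \<rho> = geod_quotient \<Gamma>"
  shows "\<exists>r>0. \<forall>\<eta>\<in>geodesic_lines. \<forall>\<theta>\<in>geodesic_lines.
     line_orbit \<Gamma> \<eta> \<in> thick Q \<longrightarrow> \<rho> (line_orbit \<Gamma> \<eta>) (line_orbit \<Gamma> \<theta>) < r \<longrightarrow>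
     (\<exists>g\<in>\<Gamma>. \<forall>t\<in>{0..W}. dist (\<eta> t) (g (\<theta> t)) < 1)"
proof -
  interpret Metric_space "topspace (geod_quotient \<Gamma>)" \<rho> by (rule \<rho>(1))
  define U where "U \<gamma> = {\<eta> \<in> geodesic_lines. \<exists>g\<in>\<Gamma>. \<forall>t\<in>{0..W}. dist (\<gamma> t) (g (\<eta> t)) < 1/2}" for \<gamma>
  have U_self: "\<gamma> \<in> U \<gamma>" if "\<gamma> \<in> geodesic_lines" for \<gamma>
    using that id_mem by (force simp: U_def)
  have "thick Q \<subseteq> \<Union> ((\<lambda>\<gamma>. line_orbit \<Gamma> ` U \<gamma>) ` geodesic_lines)"
    using U_self by (auto simp: thick_def)
  moreover have "openin mtopology V" if "V \<in> (\<lambda>\<gamma>. line_orbit \<Gamma> ` U \<gamma>) ` geodesic_lines" for V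
    using that openin_tracking[of _ "1/2" W] unfolding \<rho>(2) U_def by auto
  moreover have "compactin mtopology (thick Q)" using compactin_thick[OF proper] \<rho>(2) by simp
  ultimately obtain r where r: "r > 0"
    "\<And>y. y \<in> thick Q \<Longrightarrow> \<exists>V\<in>(\<lambda>\<gamma>. line_orbit \<Gamma> ` U \<gamma>) ` geodesic_lines. mball y r \<subseteq> V"
    using lebesgue_number by meson
  have "\<exists>g\<in>\<Gamma>. \<forall>t\<in>{0..W}. dist (\<eta> t) (g (\<theta> t)) < 1"
    if lines: "\<eta> \<in> geodesic_lines" "\<theta> \<in> geodesic_lines" and K: "line_orbit \<Gamma> \<eta> \<in> thick Q"
      and close: "\<rho> (line_orbit \<Gamma> \<eta>) (line_orbit \<Gamma> \<theta>) < r" for \<eta> \<theta>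
  proof -
    obtain \<gamma> where \<gamma>: "\<gamma> \<in> geodesic_lines" "mball (line_orbit \<Gamma> \<eta>) r \<subseteq> line_orbit \<Gamma> ` U \<gamma>"
      using r(2)[OF K] by blast
    have Y: "line_orbit \<Gamma> \<eta> \<in> topspace (geod_quotient \<Gamma>)" "line_orbit \<Gamma> \<theta> \<in> topspace (geod_quotient \<Gamma>)"
      using lines by (auto simp: topspace_geod_quotient)
    have track: "\<exists>g\<in>\<Gamma>. \<forall>t\<in>{0..W}. dist (\<gamma> t) (g (\<zeta> t)) < 1/2" if \<zeta>: "line_orbit \<Gamma> \<zeta> \<in> line_orbit \<Gamma> ` U \<gamma>" for \<zeta>
    proof -
      obtain \<zeta>' where "\<zeta>' \<in> U \<gamma>" "line_orbit \<Gamma> \<zeta>' = line_orbit \<Gamma> \<zeta>" using \<zeta> by auto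
      then obtain k g where "k \<in> \<Gamma>" "\<zeta>' = k \<circ> \<zeta>" "g \<in> \<Gamma>" "\<forall>t\<in>{0..W}. dist (\<gamma> t) (g (\<zeta>' t)) < 1/2"
        unfolding line_orbit_eq_iff' U_def by blast
      then show ?thesis by (intro bexI[of _ "g \<circ> k"]) auto
    qed
    have "line_orbit \<Gamma> \<eta> \<in> line_orbit \<Gamma> ` U \<gamma>"
      using \<gamma>(2) Y r(1) by auto
    from track[OF this] obtain g where g: "g \<in> \<Gamma>" "\<And>t. t \<in> {0..W} \<Longrightarrow> dist (\<gamma> t) (g (\<eta> t)) < 1/2" by blast
    have "line_orbit \<Gamma> \<theta> \<in> line_orbit \<Gamma> ` U \<gamma>"
      using \<gamma>(2) Y close by auto
    from track[OF this] obtain k where k: "k \<in> \<Gamma>" "\<And>t. t \<in> {0..W} \<Longrightarrow> dist (\<gamma> t) (k (\<theta> t)) < 1/2" by blast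
    have "dist (\<eta> t) ((ginv g \<circ> k) (\<theta> t)) < 1" if "t \<in> {0..W}" for t
    proof -
      have "dist (\<eta> t) ((ginv g \<circ> k) (\<theta> t)) = dist (g (\<eta> t)) (k (\<theta> t))"
        using g(1) by (simp add: dist_commute[of "\<eta> t"] dist_inv) (simp add: dist_commute)
      also have "\<dots> < 1" using g(2)[OF that] k(2)[OF that] dist_triangle3[of "g (\<eta> t)" "k (\<theta> t)" "\<gamma> t"] by simp
      finally show ?thesis .
    qed
    then show ?thesis using g(1) k(1) by blast
  qed
  then show ?thesis using r(1) by blast
qed

text \<open>The tracking elements of consecutive windows differ by an element of bounded length, so
  a set of words whose lines all track one line costs only a bounded factor per window.\<close>

lemma card_tracking_lines:
  assumes "finite F" and lines: "\<And>w. w \<in> F \<Longrightarrow> \<gamma> w \<in> geodesic_lines"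
    and base: "\<And>w. w \<in> F \<Longrightarrow> dist (\<gamma> w 0) x \<le> Q"
    and \<eta>: "\<eta> \<in> geodesic_lines" "dist (\<eta> 0) x \<le> Q" "\<And>t. 0 \<le> t \<Longrightarrow> \<exists>g\<in>\<Gamma>. dist (\<eta> t) (g x) \<le> Q"
    and W: "0 < W"
    and track: "\<And>w j. \<lbrakk>w \<in> F; j < J\<rbrakk> \<Longrightarrow>
      \<exists>g\<in>\<Gamma>. \<forall>t\<in>{real j * W..real (Suc j) * W}. dist (\<eta> t) (g (\<gamma> w t)) < 1"
    and separate: "\<And>w w'. \<lbrakk>w \<in> F; w' \<in> F; \<And>t. \<lbrakk>0 \<le> t; t < real J * W\<rbrakk> \<Longrightarrow> dist (\<gamma> w t) (\<gamma> w' t) < 2\<rbrakk>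
      \<Longrightarrow> w = w'"
  shows "card F \<le> card {g \<in> \<Gamma>. len g \<le> 2 * Q + 2} ^ J"
proof -
  let ?E = "{g \<in> \<Gamma>. len g \<le> 2 * Q + 2}"
  obtain g where g: "\<And>w j. \<lbrakk>w \<in> F; j < J\<rbrakk> \<Longrightarrow> g w j \<in> \<Gamma>"
    "\<And>w j t. \<lbrakk>w \<in> F; j < J; t \<in> {real j * W..real (Suc j) * W}\<rbrakk> \<Longrightarrow> dist (\<eta> t) (g w j (\<gamma> w t)) < 1"
    using track by metis
  obtain u where u: "\<And>t. 0 \<le> t \<Longrightarrow> u t \<in> \<Gamma>" "\<And>t. 0 \<le> t \<Longrightarrow> dist (\<eta> t) (u t x) \<le> Q"
    using \<eta>(3) by metis
  define v where "v j = u (real j * W)" for j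
  have v: "v j \<in> \<Gamma>" "dist (\<eta> (real j * W)) (v j x) \<le> Q" for j
    using u W by (simp_all add: v_def)
  \<comment> \<open>The code of \<open>w\<close> records the first tracking element and then each
    change of it, conjugated by the orbit element \<open>v j\<close> near
    \<open>\<eta> (real j * W)\<close>. At that time both adjacent windows apply, so the change
    moves \<open>\<eta> (real j * W)\<close> by less than 2; measured at \<open>x\<close> after
    conjugation it moves less than \<open>2 * Q + 2\<close>.\<close>
  define e where "e w j = (case j of 0 \<Rightarrow> g w 0
    | Suc i \<Rightarrow> ginv (v (Suc i)) \<circ> (g w (Suc i) \<circ> ginv (g w i)) \<circ> v (Suc i))" for w j
  have eE: "e w j \<in> ?E" if w: "w \<in> F" and j: "j < J" for w j
  proof (cases j)
    case 0
    have "dist (\<eta> 0) (g w 0 (\<gamma> w 0)) < 1" using g(2)[OF w j, of 0] W 0 by simp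
    moreover have "dist (g w 0 (\<gamma> w 0)) (g w 0 x) \<le> Q" using isom[OF g(1)[OF w j]] base[OF w] 0 by simp
    moreover have "dist x (g w 0 x) \<le> dist (\<eta> 0) x + dist (\<eta> 0) (g w 0 (\<gamma> w 0)) + dist (g w 0 (\<gamma> w 0)) (g w 0 x)"
      by metric
    ultimately have "len (g w 0) \<le> 2 * Q + 2" using \<eta>(2) by (simp add: len_def)
    then show ?thesis using g(1)[OF w j] 0 by (simp add: e_def)
  next
    case (Suc i)
    define y where "y = \<gamma> w (real j * W)"
    define z where "z = \<eta> (real j * W)"
    have gi: "g w i \<in> \<Gamma>" "g w j \<in> \<Gamma>" using g(1)[OF w] j Suc by auto
    have 1: "dist z (g w j y) < 1"
      unfolding z_def y_def by (rule g(2)[OF w j]) (use W in \<open>simp add: mult_right_mono\<close>)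
    have 2: "dist z (g w i y) < 1"
      unfolding z_def y_def by (rule g(2)[OF w]) (use W j Suc in \<open>simp_all add: mult_right_mono\<close>)
    define f where "f = g w j \<circ> ginv (g w i)"
    have f: "f \<in> \<Gamma>" using gi by (simp add: f_def)
    have 3: "dist (g w j y) (f z) < 1"
    proof -
      have "dist (g w j y) (f z) = dist y (ginv (g w i) z)" using isom[OF gi(2)] by (simp add: f_def)
      also have "\<dots> = dist (g w i y) z" using dist_inv[OF gi(1), of z y] by (simp add: dist_commute)
      finally show ?thesis using 2 by (simp add: dist_commute)
    qed
    have 4: "dist (f z) (f (v j x)) \<le> Q" "dist z (v j x) \<le> Q" using v(2)[of j] isom[OF f] by (simp_all add: z_def)
    have "len (e w j) = dist (v j x) (f (v j x))"
      using v(1)[of j] by (simp add: e_def Suc f_def len_def dist_commute[of x] dist_inv) (simp add: dist_commute)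
    also have "\<dots> \<le> dist z (v j x) + dist z (g w j y) + dist (g w j y) (f z) + dist (f z) (f (v j x))"
      by metric
    finally have "len (e w j) \<le> 2 * Q + 2" using 1 3 4 by linarith
    moreover have "e w j \<in> \<Gamma>" using v(1)[of j] gi by (simp add: e_def Suc)
    ultimately show ?thesis by simp
  qed
  \<comment> \<open>The tracking elements are recovered from the code one window at a time. Equal
    codes thus give equal elements in each window, and lines within 1 of the same line become within
    2 of each other.\<close>
  have inj: "inj_on (\<lambda>w. restrict (e w) {..<J}) F"
  proof (rule inj_onI)
    fix w w' assume w: "w \<in> F" "w' \<in> F" and eq: "restrict (e w) {..<J} = restrict (e w') {..<J}"
    have e_eq: "e w j = e w' j" if "j < J" for j using fun_cong[OF eq, of j] that by simp
    have g_eq: "g w j = g w' j" if "j < J" for j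
      using that
    proof (induction j)
      case 0 then show ?case using e_eq[of 0] by (simp add: e_def)
    next
      case (Suc i)
      let ?v = "v (Suc i)" and ?k = "g w i"
      have \<Gamma>: "?v \<in> \<Gamma>" "?k \<in> \<Gamma>" using v(1) g(1)[OF w(1)] Suc.prems by auto
      have same: "g w' i = ?k" using Suc by simp
      have *: "g w'' (Suc i) = ?v \<circ> (ginv ?v \<circ> (g w'' (Suc i) \<circ> ginv ?k) \<circ> ?v) \<circ> ginv ?v \<circ> ?k" for w''
        using \<Gamma> by (simp add: fun_eq_iff)
      have "ginv ?v \<circ> (g w (Suc i) \<circ> ginv ?k) \<circ> ?v = ginv ?v \<circ> (g w' (Suc i) \<circ> ginv ?k) \<circ> ?v"
        using e_eq[OF Suc.prems] same by (simp add: e_def)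
      then show ?case using *[of w] *[of w'] by metis
    qed
    show "w = w'"
    proof (rule separate[OF w])
      fix t assume t: "0 \<le> t" "t < real J * W"
      \<comment> \<open>The strict bound \<open>t < real J * W\<close> ensures that the window
        containing \<open>t\<close> is one of the first \<open>J\<close>.\<close>
      define j where "j = nat \<lfloor>t / W\<rfloor>"
      have fl: "real j \<le> t / W" "t / W < real (Suc j)"
        using t W by (auto simp: j_def) linarith
      then have tj: "t \<in> {real j * W..real (Suc j) * W}" using W by (simp add: field_simps)
      have "real j * W < real J * W" using tj t by auto
      then have j: "j < J" using W by simp
      have "dist (\<gamma> w t) (\<gamma> w' t) = dist (g w j (\<gamma> w t)) (g w j (\<gamma> w' t))"
        using isom[OF g(1)[OF w(1) j]] by simp
      also have "\<dots> < 2"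
        using g(2)[OF w(1) j tj] g(2)[OF w(2) j tj] g_eq[OF j]
          dist_triangle3[of "g w j (\<gamma> w t)" "g w j (\<gamma> w' t)" "\<eta> t"] by simp
      finally show "dist (\<gamma> w t) (\<gamma> w' t) < 2" .
    qed
  qed
  have "card F \<le> card ({..<J} \<rightarrow>\<^sub>E ?E)"
    by (rule card_inj_on_le[OF inj]) (use eE in \<open>auto intro!: finite_PiE finite_len\<close>)
  then show ?thesis by (simp add: card_funcsetE)
qed

text \<open>Words of length \<open>m\<close> number \<open>card S ^ m\<close>, and each dynamical
  ball accounts for at most \<open>NE ^ J\<close> of them. With \<open>m\<close> about
  \<open>n / L\<close> and \<open>J\<close> about \<open>n / W\<close>, the growth rate of the
  quotient is at least \<open>h - ln NE / W\<close>.\<close>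

lemma entropy_lower_bound:
  assumes geom: "proper_space TYPE('a)" "geodesic_space TYPE('a)"
    and "non_elementary \<Gamma>" and h: "0 < h" "ereal h < critical_exponent \<Gamma> x"
    and \<rho>: "Metric_space (topspace (geod_quotient \<Gamma>)) \<rho>"
      "Metric_space.mtopology (topspace (geod_quotient \<Gamma>)) \<rho> = geod_quotient \<Gamma>"
  shows "\<exists>K. compactin (geod_quotient \<Gamma>) K \<and> ereal h \<le> Lim (at_right 0) (\<lambda>r::real.
    limsup (\<lambda>n. ereal (ln (real (covering_number (topspace (geod_quotient \<Gamma>))
      (dyn_dist \<rho> (quotient_flow 1) n) K r)) / real n)))"
proof -
  let ?q = "line_orbit \<Gamma>" and ?T = "quotient_flow 1" and ?Y = "topspace (geod_quotient \<Gamma>)"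
  interpret Y: Metric_space ?Y \<rho> by (rule \<rho>(1))
  show ?thesis
  proof (rule schottky_lines[OF geom assms(3) h])
    fix L :: real and S :: "('a \<Rightarrow> 'a) set" and \<gamma> :: "(nat \<Rightarrow> 'a \<Rightarrow> 'a) \<Rightarrow> real \<Rightarrow> 'a" and Q :: real
    assume L: "0 < L" and S: "finite S" "exp (h * L) \<le> card S"
      and \<gamma>: "\<And>\<sigma>. range \<sigma> \<subseteq> S \<Longrightarrow> \<gamma> \<sigma> \<in> geodesic_lines"
        "\<And>\<sigma>. range \<sigma> \<subseteq> S \<Longrightarrow> dist (\<gamma> \<sigma> 0) x \<le> Q"
        "\<And>\<sigma> t. \<lbrakk>range \<sigma> \<subseteq> S; 0 \<le> t\<rbrakk> \<Longrightarrow> \<exists>g\<in>\<Gamma>. dist (\<gamma> \<sigma> t) (g x) \<le> Q"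
      and sep: "\<And>\<sigma> \<sigma>' m k. \<lbrakk>range \<sigma> \<subseteq> S; range \<sigma>' \<subseteq> S;
          \<And>t. \<lbrakk>0 \<le> t; t \<le> real m * L\<rbrakk> \<Longrightarrow> dist (\<gamma> \<sigma> t) (\<gamma> \<sigma>' t) < 2; k < m\<rbrakk> \<Longrightarrow> \<sigma> k = \<sigma>' k"
    have "0 < card S" using S(2) by (metis exp_gt_zero gr_zeroI leD of_nat_0)
    then obtain s0 where s0: "s0 \<in> S" by (metis card_gt_0_iff ex_in_conv)
    define K where "K = thick Q"
    define f where "f r = limsup (\<lambda>n. ereal (ln (real (covering_number ?Y (dyn_dist \<rho> ?T n) K r)) / real n))" for r :: real
    have K: "compactin (geod_quotient \<Gamma>) K" unfolding K_def by (rule compactin_thick[OF geom(1)])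
    have KY: "compactin Y.mtopology K" "continuous_map Y.mtopology Y.mtopology ?T"
      using K continuous_map_quotient_flow \<rho>(2) by simp_all
    have Kne: "K \<noteq> {}"
    proof -
      have c: "range (\<lambda>_::nat. s0) \<subseteq> S" using s0 by auto
      have "?q (\<gamma> (\<lambda>_. s0)) \<in> K" unfolding K_def
        by (rule thickI[OF \<gamma>(1)[OF c] \<gamma>(3)[OF c]]) simp
      then show ?thesis by blast
    qed
    define NE where "NE = card {g \<in> \<Gamma>. len g \<le> 2 * Q + 2}"
    have Q: "0 \<le> Q"
    proof -
      have "range (\<lambda>_::nat. s0) \<subseteq> S" using s0 by auto
      from \<gamma>(2)[OF this] show ?thesis by (meson order_trans zero_le_dist)
    qed
    have NE: "1 \<le> NE"
    proof -
      have "id \<in> {g \<in> \<Gamma>. len g \<le> 2 * Q + 2}" using Q by (simp add: len_def)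
      then show ?thesis using finite_len[of "2 * Q + 2"] unfolding NE_def by (metis One_nat_def Suc_leI card_gt_0_iff empty_iff)
    qed
    have bound: "ereal (h - ln NE / W) \<le> Lim (at_right 0) f" if W: "0 < W" for W :: nat
    proof -
      obtain r where r: "r > 0" "\<And>\<eta> \<theta>. \<lbrakk>\<eta> \<in> geodesic_lines; \<theta> \<in> geodesic_lines; ?q \<eta> \<in> K;
          \<rho> (?q \<eta>) (?q \<theta>) < r\<rbrakk> \<Longrightarrow> \<exists>g\<in>\<Gamma>. \<forall>t\<in>{0..real W}. dist (\<eta> t) (g (\<theta> t)) < 1"
        using close_orbits_track[OF geom(1) \<rho>, of Q "real W"] unfolding K_def by blast
      \<comment> \<open>Two orbits in one ball of radius \<open>r/2\<close> are within
        \<open>r\<close> at the times \<open>0, ..., n - 1\<close>. The \<open>J\<close> windows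
        starting at multiples of \<open>W\<close> up to \<open>n - 1\<close> cover the interval from
        0 to \<open>n - 1\<close>, and a word of length \<open>m\<close> is determined by its line
        up to time \<open>real m * L\<close>.\<close>
      have count: "card S ^ m \<le> covering_number ?Y (dyn_dist \<rho> ?T n) K (r/2) * NE ^ J"
        if n: "0 < n" and m: "real m * L \<le> real n - 1" and J: "J = Suc ((n - 1) div W)" for n m J
      proof -
        \<comment> \<open>Lines are attached to infinite words, so finite words are continued by a
          fixed letter.\<close>
        define ext where "ext w i = (if i < m then w i else s0)" for w :: "nat \<Rightarrow> 'a \<Rightarrow> 'a" and i
        define F where "F = {..<m} \<rightarrow>\<^sub>E S"
        have finF: "finite F" unfolding F_def using S(1) by (intro finite_PiE) auto
        have cardF: "card F = card S ^ m" by (simp add: F_def card_funcsetE)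
        have Fne: "F \<noteq> {}" using cardF \<open>0 < card S\<close> by auto
        have ext: "range (ext w) \<subseteq> S" if "w \<in> F" for w
          using that s0 by (auto simp: ext_def F_def)
        define line where "line w = \<gamma> (ext w)" for w
        have shift: "geod_flow t (line w) \<in> geodesic_lines" "?q (geod_flow t (line w)) \<in> K"
          if w: "w \<in> F" and t: "0 \<le> t" for w t
        proof -
          show 1: "geod_flow t (line w) \<in> geodesic_lines"
            unfolding line_def by (rule geod_flow_mem[OF \<gamma>(1)[OF ext[OF w]]])
          show "?q (geod_flow t (line w)) \<in> K"
            unfolding K_def by (rule thickI[OF 1]) (use \<gamma>(3)[OF ext[OF w] t] in \<open>simp add: geod_flow_def line_def\<close>)
        qed
        have lineK: "?q (line w) \<in> K" if "w \<in> F" for w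
          using shift(2)[OF that, of 0] by (simp add: geod_flow_def)
        obtain C where C: "C \<subseteq> ?Y" "finite C" "card C = covering_number ?Y (dyn_dist \<rho> ?T n) K (r/2)"
          "K \<subseteq> (\<Union>c\<in>C. {y \<in> ?Y. dyn_dist \<rho> ?T n c y < r/2})"
          using Y.covering_number_attained[OF KY(2,1) n, of "r/2"] r(1) by auto
        have "\<exists>c\<in>C. dyn_dist \<rho> ?T n c (?q (line w)) < r/2" if "w \<in> F" for w
          using C(4) lineK[OF that] by blast
        then obtain c where c: "\<And>w. w \<in> F \<Longrightarrow> c w \<in> C"
          "\<And>w. w \<in> F \<Longrightarrow> dyn_dist \<rho> ?T n (c w) (?q (line w)) < r/2" by metis
        have "c ` F \<subseteq> C" using c(1) by blast
        from pigeonhole_fiber[OF finF Fne C(2) this] obtain c0 where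
          c0: "c0 \<in> C" "card F \<le> card C * card {w \<in> F. c w = c0}" by blast
        have "card {w \<in> F. c w = c0} \<le> NE ^ J"
        proof (cases "{w \<in> F. c w = c0} = {}")
          case True then show ?thesis by (metis card.empty le0)
        next
          case False
          then obtain w0 where w0: "w0 \<in> F" "c w0 = c0" by blast
          show ?thesis unfolding NE_def
          proof (rule card_tracking_lines[where \<gamma> = line and \<eta> = "line w0" and W = "real W"])
            fix w j assume w: "w \<in> {w \<in> F. c w = c0}" and j: "j < J"
            define i where "i = j * W"
            have "j \<le> (n - 1) div W" using j J by simp
            then have "i \<le> n - 1" unfolding i_def
              by (metis div_times_less_eq_dividend mult_le_mono1 order_trans)
            then have i: "i < n" using n by simp
            have wF: "w \<in> F" using w by simp
            have dyn: "\<rho> ((?T ^^ i) c0) (?q (geod_flow i (line w))) < r/2" if "w \<in> F" "c w = c0" for w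
              using c(2)[OF that(1), unfolded dyn_dist_less_iff[OF n], rule_format, OF i] that(2)
              unfolding quotient_flow_funpow by simp
            have mem: "(?T ^^ i) c0 \<in> ?Y" "?q (geod_flow i (line w)) \<in> ?Y" "?q (geod_flow i (line w0)) \<in> ?Y"
            proof -
              show "(?T ^^ i) c0 \<in> ?Y"
                using continuous_map_image_subset_topspace[OF Y.continuous_map_iterate[OF KY(2,1), of i]] c0(1) C(1)
                by auto
            qed (use shift(1)[of _ "real i"] wF w0 in \<open>auto simp: topspace_geod_quotient\<close>)
            have "\<rho> (?q (geod_flow i (line w0))) (?q (geod_flow i (line w))) < r"
              using dyn[OF w0] dyn[of w] w Y.triangle''[OF mem(3,1,2)] Y.commute[of "(?T ^^ i) c0"]
              by auto
            from r(2)[OF shift(1)[OF w0(1)] shift(1)[OF wF] shift(2)[OF w0(1)] this]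
            obtain g where g: "g \<in> \<Gamma>" "\<And>t. t \<in> {0..real W} \<Longrightarrow> dist (geod_flow i (line w0) t) (g (geod_flow i (line w) t)) < 1"
              by auto
            have "dist (line w0 t) (g (line w t)) < 1" if "t \<in> {real j * real W..real (Suc j) * real W}" for t
              using g(2)[of "t - real i"] that by (auto simp: geod_flow_def i_def algebra_simps)
            then show "\<exists>g\<in>\<Gamma>. \<forall>t\<in>{real j * real W..real (Suc j) * real W}. dist (line w0 t) (g (line w t)) < 1"
              using g(1) by blast
          next
            fix w w' assume w: "w \<in> {w \<in> F. c w = c0}" "w' \<in> {w \<in> F. c w = c0}"
              and close: "\<And>t. \<lbrakk>0 \<le> t; t < real J * real W\<rbrakk> \<Longrightarrow> dist (line w t) (line w' t) < 2"
            have wF: "w \<in> F" "w' \<in> F" using w by auto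
            have "n - 1 < J * W" using J W by (simp add: dividend_less_div_times)
            then have "real n - 1 < real J * real W" using n by (simp flip: of_nat_mult)
            then have "ext w k = ext w' k" if "k < m" for k
              using m by (intro sep[OF ext[OF wF(1)] ext[OF wF(2)] _ that] close[unfolded line_def]) auto
            then have "w k = w' k" if "k < m" for k using that by (simp add: ext_def)
            then show "w = w'" using wF unfolding F_def by (intro PiE_ext[of w "{..<m}" "\<lambda>_. S" w']) auto
          next
            show "finite {w \<in> F. c w = c0}" using finF by simp
            show "line w \<in> geodesic_lines" if "w \<in> {w \<in> F. c w = c0}" for w
              using \<gamma>(1)[OF ext] that by (simp add: line_def)
            show "dist (line w 0) x \<le> Q" if "w \<in> {w \<in> F. c w = c0}" for w
              using \<gamma>(2)[OF ext] that by (simp add: line_def)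
            show "line w0 \<in> geodesic_lines" "dist (line w0 0) x \<le> Q"
              using \<gamma>(1,2)[OF ext[OF w0(1)]] by (simp_all add: line_def)
            show "\<exists>g\<in>\<Gamma>. dist (line w0 t) (g x) \<le> Q" if "0 \<le> t" for t
              using \<gamma>(3)[OF ext[OF w0(1)] that] by (simp add: line_def)
            show "0 < real W" using W by simp
          qed
        qed
        then have "card C * card {w \<in> F. c w = c0} \<le> card C * NE ^ J" by (rule mult_le_mono2)
        with c0(2) have "card F \<le> card C * NE ^ J" by (rule order_trans)
        then show ?thesis unfolding cardF C(3) .
      qed
      \<comment> \<open>The logarithm of the count divided by \<open>n\<close>, with
        \<open>m\<close> and \<open>J\<close> replaced by their bounds and
        \<open>ln (card S)\<close> by \<open>h * L\<close>.\<close>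
      define a where "a n = ((((real n - 1) / L - 1) * (h * L)) - ((real n - 1) / W + 1) * ln NE) / n" for n :: nat
      have "a \<longlonglongrightarrow> h - ln NE / W"
      proof -
        have "a \<longlonglongrightarrow> inverse L * (h * L) - inverse (real W) * ln NE"
          unfolding a_def using L W by real_asymp
        then show ?thesis using L by (simp add: field_simps)
      qed
      then have "limsup (\<lambda>n. ereal (a n)) = ereal (h - ln NE / W)"
        by (intro lim_imp_Limsup) simp_all
      moreover have "limsup (\<lambda>n. ereal (a n)) \<le> f (r/2)"
        unfolding f_def
      proof (rule Limsup_mono)
        show "\<forall>\<^sub>F n in sequentially. ereal (a n) \<le>
            ereal (ln (real (covering_number ?Y (dyn_dist \<rho> ?T n) K (r/2))) / real n)"
          using eventually_gt_at_top[of 0]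
        proof eventually_elim
          case (elim n)
          define m where "m = nat \<lfloor>(real n - 1) / L\<rfloor>"
          define J where "J = Suc ((n - 1) div W)"
          let ?c = "covering_number ?Y (dyn_dist \<rho> ?T n) K (r/2)"
          have fl: "real m \<le> (real n - 1) / L" "(real n - 1) / L - 1 \<le> real m"
            using elim L by (auto simp: m_def)
          then have mL: "real m * L \<le> real n - 1" using L by (simp add: field_simps)
          have JW: "real J \<le> (real n - 1) / W + 1"
            using of_nat_div_le_of_nat[of "n - 1" W, where 'a = real] elim by (simp add: J_def of_nat_diff)
          have le: "card S ^ m \<le> ?c * NE ^ J" by (rule count[OF elim mL J_def])
          have cpos: "0 < ?c" using le \<open>0 < card S\<close> by (metis gr0I mult_0 not_le zero_less_power)
          have "real (card S) ^ m \<le> real ?c * real NE ^ J"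
            using of_nat_mono[OF le, where 'a = real] by simp
          then have "ln (real (card S) ^ m) \<le> ln (real ?c * real NE ^ J)"
            using \<open>0 < card S\<close> cpos NE by simp
          then have "m * ln (card S) \<le> ln ?c + J * ln NE"
            using cpos NE \<open>0 < card S\<close> by (simp add: ln_mult ln_realpow)
          moreover have "((real n - 1) / L - 1) * (h * L) \<le> m * (h * L)"
            using fl h L by (intro mult_right_mono) auto
          moreover have "m * (h * L) \<le> m * ln (card S)"
            using S(2) \<open>0 < card S\<close> by (intro mult_left_mono) (auto simp: ln_ge_iff)
          moreover have "J * ln NE \<le> ((real n - 1) / W + 1) * ln NE"
            using JW NE by (intro mult_right_mono) auto
          ultimately have "((real n - 1) / L - 1) * (h * L) - ((real n - 1) / W + 1) * ln NE \<le> ln ?c"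
            by linarith
          then show ?case unfolding a_def by (simp add: divide_right_mono)
        qed
      qed
      moreover have "f (r/2) \<le> Lim (at_right 0) f"
        unfolding f_def by (rule Y.limsup_covering_le_Lim[OF KY(2,1) Kne]) (use r(1) in simp)
      ultimately show ?thesis by (metis order_trans)
    qed
    \<comment> \<open>\<open>NE\<close> was fixed before \<open>W\<close>, so the loss per unit of
      time vanishes as the windows grow.\<close>
    have "(\<lambda>W::nat. ereal (h - ln NE / W)) \<longlonglongrightarrow> ereal h"
    proof -
      have "(\<lambda>W::nat. h - ln NE / W) \<longlonglongrightarrow> h" by real_asymp
      then show ?thesis by simp
    qed
    then have "ereal h \<le> Lim (at_right 0) f"
      by (rule LIMSEQ_le_const2) (use bound in \<open>auto intro!: exI[of _ 1]\<close>)
    then show ?thesis using K unfolding f_def by blast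
  qed
qed

end

section \<open>From the hypotheses on the group to the theorem\<close>

lemma subgroup_isometry_group_imp_locale:
  fixes \<Gamma> :: "('a::metric_space \<Rightarrow> 'a) set" and x :: 'a
  assumes hyp: "gromov_hyperbolic TYPE('a)" and sub: "subgroup \<Gamma> isometry_group"
    and disc: "discrete_isometries \<Gamma>"
  obtains \<delta> where "discrete_hyperbolic_group \<delta> \<Gamma> x"
proof -
  obtain \<delta> where \<delta>: "0 \<le> \<delta>" "\<And>(x::'a) y z w. min (gromov_product w x y) (gromov_product w y z) - \<delta> \<le> gromov_product w x z"
    using hyp unfolding gromov_hyperbolic_def by blast
  interpret G: group "isometry_group :: ('a \<Rightarrow> 'a) monoid" by (rule group_isometry_group)
  have car: "surj g" "dist (g y) (g z) = dist y z" if "g \<in> \<Gamma>" for g y z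
    using subgroup.subset[OF sub] that by (auto simp: isometry_group_def)
  show thesis
  proof (rule that[of \<delta>], unfold_locales)
    show "id \<in> \<Gamma>" using subgroup.one_closed[OF sub] by (simp add: isometry_group_def)
    show "g \<circ> h \<in> \<Gamma>" if "g \<in> \<Gamma>" "h \<in> \<Gamma>" for g h
      using subgroup.m_closed[OF sub that] by (simp add: isometry_group_def)
    show "inv_into UNIV g \<in> \<Gamma>" if g: "g \<in> \<Gamma>" for g
    proof -
      let ?i = "m_inv isometry_group g"
      have i: "?i \<in> \<Gamma>" by (rule subgroup.m_inv_closed[OF sub g])
      have "?i \<circ> g = id"
        using G.l_inv[of g] subgroup.mem_carrier[OF sub g] by (simp add: isometry_group_def)
      then have "?i (g y) = y" for y by (metis comp_apply id_apply)
      then have "inv_into UNIV g = ?i"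
        by (metis (no_types) car(1)[OF g] ext f_inv_into_f UNIV_I)
      then show ?thesis using i by simp
    qed
    \<comment> \<open>Discreteness speaks of nonnegative radii only, hence
      \<open>max R 0\<close>.\<close>
    show "finite {g \<in> \<Gamma>. dist x (g x) \<le> R}" for R
    proof (rule finite_subset)
      show "{g \<in> \<Gamma>. dist x (g x) \<le> R} \<subseteq> {g \<in> \<Gamma>. dist x (g x) \<le> max R 0}" by auto
      show "finite {g \<in> \<Gamma>. dist x (g x) \<le> max R 0}" using disc by (simp add: discrete_isometries_def)
    qed
  qed (use \<delta> car in auto)
qed

theorem theorem3:
  fixes \<Gamma> :: "('a::metric_space \<Rightarrow> 'a) set" and x :: 'a
  assumes "proper_space TYPE('a)"
    and "geodesic_space TYPE('a)"
    and "gromov_hyperbolic TYPE('a)"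
    and "subgroup \<Gamma> isometry_group"
    and "discrete_isometries \<Gamma>"
    and "virtually_torsion_free (isometry_group\<lparr>carrier := \<Gamma>\<rparr>)"
    and "non_elementary \<Gamma>"
  shows "topological_entropy (geod_quotient \<Gamma>) (quotient_flow 1) \<ge> critical_exponent \<Gamma> x"
proof -
  obtain \<delta> where "discrete_hyperbolic_group \<delta> \<Gamma> x"
    by (rule subgroup_isometry_group_imp_locale[OF assms(3-5)])
  then interpret discrete_hyperbolic_group \<delta> \<Gamma> x .
  let ?Y = "geod_quotient \<Gamma>"
  show ?thesis
    unfolding topological_entropy_def
  proof (rule INF_greatest)
    fix \<rho> assume "\<rho> \<in> {\<rho>. Metric_space (topspace ?Y) \<rho> \<and> Metric_space.mtopology (topspace ?Y) \<rho> = ?Y}"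
    then have \<rho>: "Metric_space (topspace ?Y) \<rho>" "Metric_space.mtopology (topspace ?Y) \<rho> = ?Y" by auto
    let ?e = "\<lambda>K. Lim (at_right 0) (\<lambda>r::real. limsup (\<lambda>n. ereal (ln (real (covering_number (topspace ?Y)
        (dyn_dist \<rho> (quotient_flow 1) n) K r)) / real n)))"
    show "critical_exponent \<Gamma> x \<le> (SUP K \<in> {K. compactin ?Y K}. ?e K)"
    proof (rule dense_le)
      fix y assume y: "y < critical_exponent \<Gamma> x"
      show "y \<le> (SUP K \<in> {K. compactin ?Y K}. ?e K)"
      proof (cases "y \<le> 0")
        case True
        \<comment> \<open>Values up to 0 are reached by the empty compact set: its covering numbers
          are 0, and \<open>ln 0 = 0\<close> gives it rate 0. The counting argument requires
          \<open>h > 0\<close>.\<close>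
        have "covering_number (topspace ?Y) (dyn_dist \<rho> (quotient_flow 1) n) {} r = 0" for n r
          unfolding covering_number_def by (rule Least_eq_0) (auto intro!: exI[of _ "{}"])
        then have "?e {} = 0" by (simp add: tendsto_Lim zero_ereal_def[symmetric] Limsup_const)
        then have "0 \<le> (SUP K \<in> {K. compactin ?Y K}. ?e K)"
          by (intro SUP_upper2[of "{}"]) simp_all
        with True show ?thesis by simp
      next
        case False
        then obtain h where h: "y = ereal h" "0 < h" using y by (cases y) auto
        obtain K where "compactin ?Y K" "ereal h \<le> ?e K"
          using entropy_lower_bound[OF assms(1,2,7) h(2) _ \<rho>] y h(1) by auto
        then show ?thesis unfolding h(1) by (intro SUP_upper2[of K]) auto
      qed
    qed
  qed
qed

end
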